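(* Let $n \ge 2$ be an integer, $\sigma \in (0,1]$, $A \in \mathcal{A}_\sigma$, and $f(x)=\frac12 x^\top A x$ on $\mathbb{R}^n$. For an initial point $x_0\in\mathbb{R}^n$ with $x_0\neq 0$, let $x_K$ be the output of random-permutation coordinate descent (RPCD) applied to $f$ after $K$ epochs. Then $$\lim_{K\to\infty}\left(\frac{\mathbb{E}\left[\|x_K\|^2\right]}{\|x_0\|^2}\right)^{1/K} \le \max\left\{\left(1-\frac1n\right)^n,\ \left(1-\frac{\sigma}{n}\right)^{2n}\right\}.$$
   Context: Function class: for $\sigma\in(0,1]$, $\mathcal{A}_\sigma^{\mathrm{PI}}$ is the set of $n\times n$ block-diagonal matrices $\mathrm{diag}\{\sigma I_k + (1-\sigma)\mathbf{1}_k\mathbf{1}_k^\top,\ I_{n-k}\}$ with $2\le k\le n$ an integer, where $I_k$ is the $k\times k$ identity and $\mathbf{1}_k$ the all-ones vector in $\mathbb{R}^k$. Then $\mathcal{A}_\sigma = \{A^{\mathrm{PI}}\odot vv^\top : A^{\mathrm{PI}}\in\mathcal{A}_\sigma^{\mathrm{PI}},\ v\in\{\pm1\}^n\}$, where $\odot$ is the entrywise (Hadamard) product. All matrices in $\mathcal{A}_\sigma$ are symmetric positive definite with unit diagonal. Random-permutation coordinate descent (RPCD) on $f(x)=\frac12x^\top Ax$: in each epoch a permutation $p$ of $\{1,\dots,n\}$ is drawn uniformly at random, independently across epochs, and the coordinates $p(1),p(2),\dots,p(n)$ are updated successively in this order; each update replaces the selected coordinate of the current point by the exact minimizer of $f$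 over that coordinate with the others fixed (i.e. $x\mapsto (I-E_iA)x$ with $E_i=e_ie_i^\top$ when coordinate $i$ is updated). $x_K$ denotes the point after $K$ epochs, i.e. after $nK$ coordinate updates, starting from the deterministic point $x_0$. $\|\cdot\|$ is the Euclidean norm and the expectation is over the random permutations, conditional on $x_0$. *)

theory Defs
  imports
    "HOL-Probability.Probability_Mass_Function"
    "Jordan_Normal_Form.Matrix"
begin

unbundle no inner_syntax and no vec_syntax
hide_const (open) Finite_Cartesian_Product.vec Finite_Cartesian_Product.mat
  Finite_Cartesian_Product.row

section \<open>The matrix classes\<close>

definition ones_vec :: "nat \<Rightarrow> real vec" where
  "ones_vec k = vec k (\<lambda>_. 1)"

definition outer_prod :: "real vec \<Rightarrow> real vec \<Rightarrow> real mat" where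
  "outer_prod u v = mat (dim_vec u) (dim_vec v) (\<lambda>(i, j). u $ i * v $ j)"

definition hadamard :: "real mat \<Rightarrow> real mat \<Rightarrow> real mat" where
  "hadamard A B = mat (dim_row A) (dim_col A) (\<lambda>(i, j). A $$ (i, j) * B $$ (i, j))"

definition PI_class :: "nat \<Rightarrow> real \<Rightarrow> real mat set" where
  "PI_class n \<sigma> =
     {diag_block_mat [\<sigma> \<cdot>\<^sub>m 1\<^sub>m k + (1 - \<sigma>) \<cdot>\<^sub>m outer_prod (ones_vec k) (ones_vec k), 1\<^sub>m (n - k)] | k.
        2 \<le> k \<and> k \<le> n}"

definition A_class :: "nat \<Rightarrow> real \<Rightarrow> real mat set" where
  "A_class n \<sigma> =
     {hadamard P (outer_prod v v) | P v.
        P \<in> PI_class n \<sigma> \<and> v \<in> carrier_vec n \<and> (\<forall>i<n. v $ i \<in> {1, -1})}"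

section \<open>Random-permutation coordinate descent\<close>

definition quadratic :: "real mat \<Rightarrow> real vec \<Rightarrow> real" where
  "quadratic A x = 1 / 2 * (x \<bullet> (A *\<^sub>v x))"

definition euclid_norm :: "real vec \<Rightarrow> real" where
  "euclid_norm x = sqrt (x \<bullet> x)"

text \<open>
  Exact minimization over the \<open>i\<close>-th coordinate. The value is meaningful only if a unique minimizer
  exists; lemma \<open>coord_step_quadratic\<close> below shows that this is the case for the objectives of
  interest, where the step is the linear map \<open>x \<mapsto> (I - E\<^sub>i A) x\<close>.
\<close>

definition coord_step :: "(real vec \<Rightarrow> real) \<Rightarrow> nat \<Rightarrow> real vec \<Rightarrow> real vec" where
  "coord_step f i x = x |\<^sub>v i \<mapsto> (ARG_MIN (\<lambda>t. f (x |\<^sub>v i \<mapsto> t)) t. True)"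

text \<open>
  Coordinates are numbered \<open>0, \<dots>, n - 1\<close>; an epoch with permutation \<open>p\<close> updates the coordinates
  \<open>p 0, p 1, \<dots>, p (n - 1)\<close> in this order.
\<close>

definition rpcd_epoch :: "(real vec \<Rightarrow> real) \<Rightarrow> nat \<Rightarrow> (nat \<Rightarrow> nat) \<Rightarrow> real vec \<Rightarrow> real vec" where
  "rpcd_epoch f n p x = fold (coord_step f) (map p [0..<n]) x"

text \<open>
  The distribution of the iterate after \<open>K\<close> epochs. Drawing a fresh uniform permutation in
  every monadic step makes the permutations of different epochs independent.
\<close>

primrec rpcd :: "(real vec \<Rightarrow> real) \<Rightarrow> nat \<Rightarrow> real vec \<Rightarrow> nat \<Rightarrow> real vec pmf" where
  "rpcd f n x0 0 = return_pmf x0"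
| "rpcd f n x0 (Suc K) =
     bind_pmf (rpcd f n x0 K) (\<lambda>x.
       map_pmf (\<lambda>p. rpcd_epoch f n p x) (pmf_of_set {p. p permutes {..<n}}))"

section \<open>Adequacy of the coordinate step\<close>

lemma A_class_carrier:
  assumes "A \<in> A_class n \<sigma>"
  shows "A \<in> carrier_mat n n"
  using assms by (auto simp: A_class_def PI_class_def hadamard_def outer_prod_def ones_vec_def)

lemma A_class_symmetric:
  assumes "A \<in> A_class n \<sigma>" "i < n" "j < n"
  shows "A $$ (i, j) = A $$ (j, i)"
  using assms
  by (auto simp: A_class_def PI_class_def hadamard_def outer_prod_def ones_vec_def)

lemma A_class_unit_diag:
  assumes "A \<in> A_class n \<sigma>" "i < n"
  shows "A $$ (i, i) = 1"
proof -
  have "v $ i * v $ i = (1::real)" if "\<forall>i<n. v $ i = 1 \<or> v $ i = - 1" for v :: "real vec"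
    using that assms(2) by fastforce
  then show ?thesis using assms
    by (auto simp: A_class_def PI_class_def hadamard_def outer_prod_def ones_vec_def)
qed

lemma update_vec_eq_add_unit:
  fixes x :: "real vec"
  assumes "x \<in> carrier_vec n" "i < n"
  shows "x |\<^sub>v i \<mapsto> t = x + (t - x $ i) \<cdot>\<^sub>v unit_vec n i"
  using assms by (intro eq_vecI) (auto simp: update_vec_def)

lemma quadratic_update_vec:
  assumes A: "A \<in> carrier_mat n n" and sym: "\<And>i j. i < n \<Longrightarrow> j < n \<Longrightarrow> A $$ (i, j) = A $$ (j, i)"
    and unit: "A $$ (i, i) = 1" and x: "x \<in> carrier_vec n" and i: "i < n"
  shows "quadratic A (x |\<^sub>v i \<mapsto> t) =
    quadratic A x - (row A i \<bullet> x)\<^sup>2 / 2 + (t - (x $ i - row A i \<bullet> x))\<^sup>2 / 2"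
proof -
  let ?e = "unit_vec n i :: real vec" and ?d = "t - x $ i"
  have e: "?e \<in> carrier_vec n" by simp
  have col: "A *\<^sub>v ?e = row A i"
    using A i sym by (intro eq_vecI) auto
  have r: "row A i \<in> carrier_vec n" using A i by auto
  have Ax: "A *\<^sub>v x \<in> carrier_vec n" using A x by (rule mult_mat_vec_carrier)
  have mv: "A *\<^sub>v (x + ?d \<cdot>\<^sub>v ?e) = A *\<^sub>v x + ?d \<cdot>\<^sub>v row A i"
    using A x e by (simp add: mult_add_distrib_mat_vec[OF A] mult_mat_vec[OF A] col)
  have s1: "?e \<bullet> (A *\<^sub>v x) = row A i \<bullet> x"
    using A i x by simp
  have s2: "?e \<bullet> row A i = 1"
    using A i unit by simp
  have s3: "x \<bullet> row A i = row A i \<bullet> x"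
    using comm_scalar_prod[OF x r] .
  have "(x + ?d \<cdot>\<^sub>v ?e) \<bullet> (A *\<^sub>v x + ?d \<cdot>\<^sub>v row A i) =
      x \<bullet> (A *\<^sub>v x) + 2 * ?d * (row A i \<bullet> x) + ?d\<^sup>2"
    using x e r Ax s1 s2 s3
    by (simp add: add_scalar_prod_distrib[of _ n] scalar_prod_add_distrib[of _ n]
        smult_scalar_prod_distrib[of _ n] scalar_prod_smult_distrib[of _ n]
        power2_eq_square algebra_simps del: scalar_prod_left_unit)
  then show ?thesis
    unfolding quadratic_def update_vec_eq_add_unit[OF x i] mv
    by (simp add: power2_eq_square field_simps)
qed

lemma coord_step_quadratic:
  assumes A: "A \<in> A_class n \<sigma>" and x: "x \<in> carrier_vec n" and i: "i < n"
  shows "is_arg_min (\<lambda>t. quadratic A (x |\<^sub>v i \<mapsto> t)) (\<lambda>_. True) s \<longleftrightarrow> s = x $ i - row A i \<bullet> x"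
    and "coord_step (quadratic A) i x =
      (1\<^sub>m n - outer_prod (unit_vec n i) (unit_vec n i) * A) *\<^sub>v x"
proof -
  let ?m = "x $ i - row A i \<bullet> x"
  note car = A_class_carrier[OF A]
  have q: "quadratic A (x |\<^sub>v i \<mapsto> t) = quadratic A x - (row A i \<bullet> x)\<^sup>2 / 2 + (t - ?m)\<^sup>2 / 2" for t
    using quadratic_update_vec[OF car _ _ x i] A_class_symmetric[OF A] A_class_unit_diag[OF A i]
    by blast
  have min: "is_arg_min (\<lambda>t. quadratic A (x |\<^sub>v i \<mapsto> t)) (\<lambda>_. True) s \<longleftrightarrow> s = ?m" for s
  proof
    assume "is_arg_min (\<lambda>t. quadratic A (x |\<^sub>v i \<mapsto> t)) (\<lambda>_. True) s"
    then have "\<not> (?m - ?m)\<^sup>2 < (s - ?m)\<^sup>2"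
      unfolding is_arg_min_def q by (auto dest: spec[of _ ?m])
    then show "s = ?m" by simp
  qed (simp add: is_arg_min_def q)
  then show "is_arg_min (\<lambda>t. quadratic A (x |\<^sub>v i \<mapsto> t)) (\<lambda>_. True) s \<longleftrightarrow> s = ?m" .
  have "(ARG_MIN (\<lambda>t. quadratic A (x |\<^sub>v i \<mapsto> t)) t. True) = ?m"
    unfolding arg_min_def min by simp
  then have step: "coord_step (quadratic A) i x = x |\<^sub>v i \<mapsto> ?m"
    by (simp add: coord_step_def)
  let ?E = "outer_prod (unit_vec n i) (unit_vec n i)"
  have E: "?E \<in> carrier_mat n n" by (simp add: outer_prod_def)
  have Ej: "row ?E j = (if j = i then unit_vec n i else 0\<^sub>v n)" if "j < n" for j
    using that by (intro eq_vecI) (auto simp: outer_prod_def unit_vec_def)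
  have "(1\<^sub>m n - ?E * A) *\<^sub>v x = x - ?E *\<^sub>v (A *\<^sub>v x)"
    using car E x by (simp add: minus_mult_distrib_mat_vec[of _ n n] assoc_mult_mat_vec[of _ n n _ n])
  also have "\<dots> = x |\<^sub>v i \<mapsto> ?m"
  proof (rule eq_vecI)
    fix j assume "j < dim_vec (x |\<^sub>v i \<mapsto> ?m)"
    then have j: "j < n" using x by simp
    have "(?E *\<^sub>v (A *\<^sub>v x)) $ j = row ?E j \<bullet> (A *\<^sub>v x)"
      using E j by simp
    also have "\<dots> = (if j = i then row A i \<bullet> x else 0)"
      using car i x by (simp add: Ej[OF j])
    finally show "(x - ?E *\<^sub>v (A *\<^sub>v x)) $ j = (x |\<^sub>v i \<mapsto> ?m) $ j"
      using E x j by (auto simp: update_vec_def)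
  qed (use E x in auto)
  finally show "coord_step (quadratic A) i x = (1\<^sub>m n - ?E * A) *\<^sub>v x"
    using step by simp
qed

end

theory Submission
  imports Defs
begin

text \<open>
  After flipping signs, only the first \<open>k\<close> coordinates interact, and the remaining ones vanish after one
  epoch. Let \<open>S\<close> be the signed sum and \<open>U\<close> the squared norm of the mean-free part of the block.
  Averaging over the order of the block maps quadratic forms in \<open>U\<close> and \<open>S\<^sup>2\<close> to such forms, so
  \<open>(E U, E S\<^sup>2)\<close> evolves by a nonnegative \<open>2 \<times> 2\<close> matrix. Its positive left eigenvector gives a quadratic
  form that is multiplied by the Perron root \<open>l\<close> in every epoch and is comparable to the squared norm;
  hence the limit is \<open>l\<close>, or \<open>0\<close> when \<open>\<sigma> = 1\<close> or the initial block vanishes. The root \<open>l\<close> is at most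
  the larger column sum. For \<open>\<sigma> \<le> 1/2\<close> the column sums are compared with a Pade approximant of
  \<open>(1 - \<sigma>/k)\<^sup>2\<^sup>k\<close>, for \<open>\<sigma> \<ge> 1/2\<close> with \<open>(1 - 1/k)\<^sup>k\<close>. Finally both bounds increase in \<open>k\<close>.
\<close>

section \<open>Powers and Perron roots\<close>

text \<open>Updating a block coordinate \<open>i\<close> replaces \<open>S\<close> by
  \<open>\<sigma> * (S - w i * x $ i)\<close>, and the new signed coordinate is
  \<open>- (1 - \<sigma>) / \<sigma>\<close> times the new \<open>S\<close>. So every quantity of an
  epoch is a linear form in the initial block with geometric weights. Its mean square over a uniform
  order depends only on the total and the variance of the block and on the first two power sums of
  the weights; this is why two quantities suffice. For fixed \<open>\<sigma>\<close> and growing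
  \<open>k\<close> both column sums tend to \<open>D = (1 - \<sigma>) / (1 + \<sigma>)\<close>, the
  [1/1] Pade approximant of \<open>exp (- 2 * \<sigma>)\<close>, which is the limit of
  \<open>(1 - \<sigma> / k) ^ (2 * k)\<close>. The column sum bound thus loses nothing in leading
  order; the difficulty lies in the terms of order \<open>1 / k\<close>, where small
  \<open>k\<close> leave little room. From \<open>\<sigma> = 1/2\<close> on, \<open>D\<close> is at
  most 1/3, below the limit \<open>exp (- 1)\<close> of \<open>(1 - 1 / k) ^ k\<close>; hence the
  switch there. If \<open>\<sigma>\<close> tends to 1 with \<open>k * (1 - \<sigma>)\<close>
  bounded, the second column sum need not approach \<open>D\<close>, and a bound uniform in
  \<open>k\<close> is required.\<close>

lemma one_minus_power_lower:
  fixes y :: real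
  assumes "0 \<le> y" "y \<le> 1"
  shows "1 - (real m + 2) * y / 2 \<le> (1 - y) ^ Suc m * (1 + real m * y / 2)"
proof (induction m)
  case (Suc m)
  let ?c = "(real m + 1) / 2"
  have pos: "1 + real m * y / 2 > 0" using assms by (simp add: add_pos_nonneg)
  \<comment> \<open>With \<open>N = m + 1\<close> the claim bounds \<open>(1 - y) ^ N\<close> from
    below by its [1/1] Pade approximant, cleared of the denominator. From \<open>N\<close> to
    \<open>N + 1\<close> the approximants miss the exact recursion only by this nonnegative cubic
    term.\<close>
  have "(1 - (?c + 1) * y) * (1 + (?c - 1/2) * y) + ?c * (?c + 1/2) * y ^ 3
      = (1 - y) * (1 + ?c * y) * (1 - (?c + 1/2) * y)"
    by (simp add: field_simps power3_eq_cube)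
  moreover have "0 \<le> ?c * (?c + 1/2) * y ^ 3" using assms by simp
  ultimately have 1: "(1 - (?c + 1) * y) * (1 + (?c - 1/2) * y)
      \<le> (1 - y) * (1 + ?c * y) * (1 - (?c + 1/2) * y)"
    by linarith
  have "(1 - y) * (1 + ?c * y) * (1 - (?c + 1/2) * y)
      \<le> (1 - y) * (1 + ?c * y) * ((1 - y) ^ Suc m * (1 + real m * y / 2))"
  proof (rule mult_left_mono)
    have "1 - (?c + 1/2) * y = 1 - (real m + 2) * y / 2" by (simp add: field_simps)
    then show "1 - (?c + 1/2) * y \<le> (1 - y) ^ Suc m * (1 + real m * y / 2)"
      using Suc.IH by (simp only:)
  qed (use assms in simp)
  with 1 have "(1 - (?c + 1) * y) * (1 + real m * y / 2)
      \<le> ((1 - y) ^ Suc (Suc m) * (1 + ?c * y)) * (1 + real m * y / 2)"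
    by (simp add: algebra_simps diff_divide_distrib add_divide_distrib)
  from mult_right_le_imp_le[OF this pos] show ?case
    by (simp add: field_simps)
qed simp

lemma one_minus_div_power_mono:
  fixes c :: real
  assumes "0 \<le> c" "c < real k" "k \<le> n"
  shows "(1 - c / real k) ^ k \<le> (1 - c / real n) ^ n"
  using assms(3)
proof (induction rule: dec_induct)
  case (step m)
  have m: "c < real m" using assms step by linarith
  then have m0: "0 < real m" using assms by linarith
  \<comment> \<open>Chosen so that passing from \<open>m\<close> to \<open>m + 1\<close> multiplies
    the base by \<open>1 + t\<close>. Then \<open>1 + (m + 1) * t\<close> is exactly the reciprocal
    of the old base, and Bernoulli's inequality repays the extra factor.\<close>
  define t where "t = c / (real (Suc m) * (real m - c))"
  have t: "0 \<le> t" using assms m by (simp add: t_def)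
  have t_mult: "t * (real (Suc m) * (real m - c)) = c"
    using m by (simp add: t_def)
  have e: "1 - c / real (Suc m) = (1 - c / real m) * (1 + t)"
    using m0 t_mult by (simp add: field_simps)
  have "1 + real (Suc m) * t \<le> (1 + t) ^ Suc m"
    using t by (intro Bernoulli_inequality) auto
  moreover have "1 + real (Suc m) * t = 1 / (1 - c / real m)"
  proof -
    have "(1 + real (Suc m) * t) * (real m - c) = real m"
      using t_mult by (simp add: algebra_simps)
    then show ?thesis using m m0 by (simp add: field_simps)
  qed
  ultimately have b: "1 / (1 - c / real m) \<le> (1 + t) ^ Suc m" by simp
  have pos: "0 < 1 - c / real m" using m m0 by (simp add: field_simps)
  have "(1 - c / real m) ^ m = (1 - c / real m) ^ Suc m * (1 / (1 - c / real m))"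
    using pos by simp
  also have "\<dots> \<le> (1 - c / real m) ^ Suc m * (1 + t) ^ Suc m"
    using b pos by (intro mult_left_mono) auto
  also have "\<dots> = (1 - c / real (Suc m)) ^ Suc m"
    by (simp only: e power_mult_distrib)
  finally show ?case using step.IH by linarith
qed simp

text \<open>Tuned to the column sums: times \<open>k - 1\<close> the left side is
  \<open>(k - 2) / 3 + 1/4\<close>. It is attained at \<open>k = 2\<close> and stays below 1/3,
  which the increasing right side exceeds from \<open>k = 6\<close> on.\<close>

lemma one_minus_inverse_power_lower:
  assumes "2 \<le> k"
  shows "1 / 3 - 1 / (12 * (real k - 1)) \<le> (1 - 1 / real k) ^ k"
proof -
  consider "k = 2" | "k = 3" | "k = 4" | "k = 5" | "6 \<le> k" using assms by linarith
  then show ?thesis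
  proof cases
    case 5
    have "1 / 3 - 1 / (12 * (real k - 1)) \<le> 1 / 3" using assms by simp
    also have "\<dots> \<le> (1 - 1 / real 6) ^ 6" by (simp add: power_numeral_reduce)
    also have "\<dots> \<le> (1 - 1 / real k) ^ k"
      using 5 by (intro one_minus_div_power_mono) auto
    finally show ?thesis .
  qed (simp_all add: power_numeral_reduce)
qed

text \<open>With \<open>g = exp (- m)\<close> this is \<open>(1 - g) / m - g \<le> 1/3\<close>,
  cleared of denominators. The difference has derivative \<open>3 - exp x * (2 - x)\<close>, which
  is nonnegative because \<open>2 - x \<le> exp (1 - x)\<close> and
  \<open>exp 1 \<le> 3\<close>.\<close>

lemma exp_mult_3_minus_le:
  fixes m :: real
  assumes "0 \<le> m"
  shows "exp m * (3 - m) \<le> 3 + 3 * m"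
proof -
  define f where "f = (\<lambda>m::real. 3 + 3 * m - exp m * (3 - m))"
  have "f 0 \<le> f m"
  proof (rule DERIV_nonneg_imp_nondecreasing[OF assms])
    fix x :: real
    have "(f has_real_derivative 3 - exp x * (2 - x)) (at x)"
      unfolding f_def by (auto intro!: derivative_eq_intros simp: algebra_simps)
    moreover have "exp x * (2 - x) \<le> 3"
    proof -
      have "exp x * (2 - x) \<le> exp x * exp (1 - x)"
        using exp_ge_add_one_self[of "1 - x"] by (intro mult_left_mono) auto
      also have "\<dots> = exp 1" by (simp flip: exp_add)
      finally show ?thesis using exp_le by linarith
    qed
    ultimately show "\<exists>y. (f has_real_derivative y) (at x) \<and> 0 \<le> y" by force
  qed
  then show ?thesis by (simp add: f_def)
qed

text \<open>\<open>(1, c)\<close> is the left eigenvector for the larger characteristic root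
  \<open>l\<close>. If \<open>l > r\<close>, then \<open>l - m11 > m21\<close> and
  \<open>l - m22 > m12\<close>, against \<open>(l - m11) * (l - m22) = m12 * m21\<close>. Positivity
  of \<open>l\<close> comes from \<open>m22 < l\<close>; the sign of \<open>m11\<close> is left
  open.\<close>

lemma perron_2x2:
  fixes m11 m12 m21 m22 r :: real
  assumes pos: "0 < m12" "0 < m21" "0 \<le> m22" and r: "m11 + m21 \<le> r" "m12 + m22 \<le> r"
  obtains l c where "0 < l" "l \<le> r" "0 < c" "m11 + c * m21 = l" "m12 + c * m22 = l * c"
proof -
  define s where "s = sqrt ((m11 - m22)\<^sup>2 + 4 * (m12 * m21))"
  define l where "l = (m11 + m22 + s) / 2"
  have prod: "0 < m12 * m21" using pos by simp
  have "\<bar>m11 - m22\<bar> = sqrt ((m11 - m22)\<^sup>2)" by simp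
  also have "\<dots> < s" unfolding s_def using prod by (intro real_sqrt_less_mono) simp
  finally have "\<bar>m11 - m22\<bar> < s" .
  then have l: "m11 < l" "m22 < l" by (auto simp: l_def)
  have "s\<^sup>2 = (m11 - m22)\<^sup>2 + 4 * (m12 * m21)" unfolding s_def using prod by simp
  then have char: "(l - m11) * (l - m22) = m12 * m21"
    by (simp add: l_def power2_eq_square field_simps)
  have "l \<le> r"
  proof (rule ccontr)
    assume "\<not> l \<le> r"
    then have "m21 < l - m11" "m12 < l - m22" using r by linarith+
    then have "m21 * m12 < (l - m11) * (l - m22)" using pos by (intro mult_strict_mono) auto
    then show False using char by (simp add: mult.commute)
  qed
  moreover have "m11 + (l - m11) / m21 * m21 = l" using pos by simp
  moreover have "m12 + (l - m11) / m21 * m22 = l * ((l - m11) / m21)"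
    using char pos by (simp add: field_simps)
  ultimately show ?thesis using that[of l "(l - m11) / m21"] l pos by auto
qed

text \<open>Constant factors disappear under the \<open>K\<close>-th root. The bounds start at
  \<open>K = 1\<close> because the initial point may have nonzero coordinates outside the
  block.\<close>

lemma tendsto_root_geometric_bounds:
  fixes N :: "nat \<Rightarrow> real"
  assumes pos: "0 < c1" "0 < c2" "0 < l"
    and bounds: "\<And>K. 1 \<le> K \<Longrightarrow> c1 * l ^ K \<le> N K" "\<And>K. 1 \<le> K \<Longrightarrow> N K \<le> c2 * l ^ K"
  shows "(\<lambda>K. N K powr (1 / real K)) \<longlonglongrightarrow> l"
proof -
  have root: "(c * l ^ K) powr (1 / real K) = c powr (1 / real K) * l" if "0 < c" "1 \<le> K" for c K
    using that pos by (simp add: powr_mult powr_powr flip: powr_realpow)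
  have lim: "(\<lambda>K. c powr (1 / real K) * l) \<longlonglongrightarrow> l" if "0 < c" for c
  proof -
    have "(\<lambda>K. c powr (1 / real K)) \<longlonglongrightarrow> c powr 0"
      using that by (intro tendsto_powr tendsto_const lim_1_over_n) auto
    then show ?thesis using that tendsto_mult_right[of _ 1 sequentially l] by simp
  qed
  show ?thesis
  proof (rule tendsto_sandwich[OF _ _ lim[OF pos(1)] lim[OF pos(2)]])
    show "\<forall>\<^sub>F K in sequentially. c1 powr (1 / real K) * l \<le> N K powr (1 / real K)"
      using eventually_ge_at_top[of 1]
    proof eventually_elim
      case (elim K)
      then show ?case using bounds(1)[OF elim] pos
        by (auto simp flip: root intro!: powr_mono2)
    qed
    show "\<forall>\<^sub>F K in sequentially. N K powr (1 / real K) \<le> c2 powr (1 / real K) * l"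
      using eventually_ge_at_top[of 1]
    proof eventually_elim
      case (elim K)
      have "0 \<le> c1 * l ^ K" using pos by simp
      then have "0 \<le> N K" using bounds(1)[OF elim] by linarith
      then show ?case using bounds(2)[OF elim] pos elim
        by (auto simp flip: root intro!: powr_mono2)
    qed
  qed
qed

section \<open>The column sums\<close>

locale geometric_mean =
  fixes a :: real and k :: nat
  assumes a_pos: "0 < a" and a_lt_1: "a < 1" and k_ge_2: "2 \<le> k"
begin

section \<open>Mean, mean square and variance of the powers
  \<open>1, a, ..., a ^ (k - 1)\<close>\<close>

definition g where "g = a ^ k"
definition p where "p = (\<Sum>j<k. a ^ j) / real k"
definition q where "q = (\<Sum>j<k. a ^ (2 * j)) / real k"
definition V where "V = q - p\<^sup>2"
definition D where "D = (1 - a) / (1 + a)"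

lemma k_real: "2 \<le> real k" using k_ge_2 by simp

lemma p_eq: "real k * (1 - a) * p = 1 - g"
  using one_diff_power_eq[of a k] k_real by (simp add: p_def g_def)

lemma q_eq: "real k * (1 - a\<^sup>2) * q = 1 - g\<^sup>2"
  using one_diff_power_eq[of "a\<^sup>2" k] k_real
  by (simp add: q_def g_def power_mult mult.commute flip: power_mult)

lemma g_pos: "0 < g" using a_pos by (simp add: g_def)

lemma g_le: "g \<le> a\<^sup>2"
  unfolding g_def using a_pos a_lt_1 k_ge_2 by (intro power_decreasing) auto

lemma a2_lt: "a\<^sup>2 < 1" using a_pos a_lt_1 by (simp add: power_less_one_iff)

lemma g_lt_1: "g < 1" using g_le a2_lt by linarith

lemma p_pos: "0 < p"
proof -
  have "0 < real k * (1 - a) * p" "0 < real k * (1 - a)" using p_eq g_lt_1 a_lt_1 k_real by simp_all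
  then show ?thesis by (simp only: zero_less_mult_pos)
qed

lemma p_le: "p \<le> 1 / (real k * (1 - a))"
proof -
  have "p * (real k * (1 - a)) \<le> 1" using p_eq g_pos by (simp add: mult_ac)
  then show ?thesis using a_lt_1 k_real by (simp add: pos_le_divide_eq)
qed

lemma q_le: "q \<le> 1 / (real k * (1 - a\<^sup>2))"
proof -
  have "q * (real k * (1 - a\<^sup>2)) \<le> 1" using q_eq by (simp add: mult_ac)
  then show ?thesis using a2_lt k_real by (simp add: pos_le_divide_eq)
qed

lemma q_eq_p: "q = p * ((1 + g) / (1 + a))"
proof -
  have "(real k * (1 - a)) * ((1 + a) * q) = (real k * (1 - a)) * (p * (1 + g))"
  proof -
    have "(real k * (1 - a)) * ((1 + a) * q) = real k * (1 - a\<^sup>2) * q"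
      by (simp add: algebra_simps power2_eq_square)
    also have "\<dots> = (1 - g) * (1 + g)"
      unfolding q_eq by (simp add: algebra_simps power2_eq_square)
    also have "\<dots> = (real k * (1 - a)) * (p * (1 + g))"
      unfolding p_eq[symmetric] by simp
    finally show ?thesis .
  qed
  then have "(1 + a) * q = p * (1 + g)" using a_lt_1 k_real by simp
  then show ?thesis using a_pos by (simp add: field_simps)
qed

lemma q_pos: "0 < q" unfolding q_eq_p using p_pos g_pos a_pos by simp

lemma q_le_1: "q \<le> 1"
proof -
  have "(\<Sum>j<k. a ^ (2 * j)) \<le> (\<Sum>j<k. 1)"
    using a_pos a_lt_1 by (intro sum_mono power_le_one) auto
  then show ?thesis unfolding q_def using k_real by (simp add: divide_le_eq)
qed

text \<open>All powers but the first are at most \<open>a\<close>, and \<open>k \<ge> 2\<close>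
  gives the first a weight of at most one half; equality holds at \<open>k = 2\<close>.\<close>

lemma p_le_half: "p \<le> (1 + a) / 2"
proof -
  obtain m where m: "k = Suc m" using k_ge_2 by (cases k) auto
  have "(\<Sum>j<k. a ^ j) = 1 + (\<Sum>j<m. a ^ Suc j)"
    unfolding m sum.lessThan_Suc_shift by simp
  also have "\<dots> \<le> 1 + (\<Sum>j<m. a)"
    using a_pos a_lt_1 by (intro add_left_mono sum_mono) (auto simp: mult_left_le power_le_one)
  also have "\<dots> = 1 + (real k - 1) * a" by (simp add: m)
  also have "\<dots> \<le> real k * ((1 + a) / 2)"
  proof -
    have "0 \<le> (real k - 2) * (1 - a)" using k_real a_lt_1 by simp
    then show ?thesis by (simp add: algebra_simps)
  qed
  finally show ?thesis unfolding p_def using k_real by (simp add: divide_le_eq mult.commute)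
qed

lemma V_variance: "real k * V = (\<Sum>j<k. (a ^ j - p)\<^sup>2)"
proof -
  have "(\<Sum>j<k. (a ^ j - p)\<^sup>2) = (\<Sum>j<k. a ^ (2 * j)) - 2 * p * (\<Sum>j<k. a ^ j) + real k * p\<^sup>2"
  proof -
    have "(a ^ j - p)\<^sup>2 = a ^ (2 * j) - 2 * p * a ^ j + p\<^sup>2" for j
      unfolding power2_diff power_even_eq by simp
    then show ?thesis by (simp add: sum.distrib sum_subtractf sum_distrib_left)
  qed
  also have "(\<Sum>j<k. a ^ (2 * j)) = real k * q" using k_real by (simp add: q_def)
  also have "(\<Sum>j<k. a ^ j) = real k * p" using k_real by (simp add: p_def)
  finally show ?thesis by (simp add: V_def algebra_simps power2_eq_square)
qed

lemma V_pos: "0 < V"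
proof -
  have "0 < (1 - p)\<^sup>2" using p_le_half a_lt_1 by simp
  also have "\<dots> = (\<Sum>j\<in>{0}. (a ^ j - p)\<^sup>2)" by simp
  also have "\<dots> \<le> (\<Sum>j<k. (a ^ j - p)\<^sup>2)" using k_ge_2 by (intro sum_mono2) auto
  finally show ?thesis using k_real by (simp add: zero_less_mult_iff flip: V_variance)
qed

text \<open>By \<open>q_eq_p\<close> the variance is \<open>p * t - p\<^sup>2\<close> with
  \<open>t = (1 + g) / (1 + a)\<close>, which is largest at \<open>p = t / 2\<close>.\<close>

lemma V_le: "V \<le> ((1 + g) / (1 + a))\<^sup>2 / 4"
proof -
  define t where "t = (1 + g) / (1 + a)"
  have "0 \<le> (t / 2 - p)\<^sup>2" by simp
  then show ?thesis unfolding V_def q_eq_p t_def[symmetric]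
    by (simp add: power2_eq_square algebra_simps)
qed

text \<open>\<open>a * p\<close> is the mean of \<open>a, ..., a ^ k\<close>, of which
  \<open>g\<close> is the smallest.\<close>

lemma ap_minus_g_nonneg: "0 \<le> a * p - g"
proof -
  have "real k * g = (\<Sum>j<k. g)" by simp
  also have "\<dots> \<le> (\<Sum>j<k. a * a ^ j)"
  proof (rule sum_mono)
    fix j assume "j \<in> {..<k}"
    then show "g \<le> a * a ^ j" unfolding g_def power_Suc[symmetric]
      using a_pos a_lt_1 by (intro power_decreasing) auto
  qed
  also have "\<dots> = real k * (a * p)" using k_real by (simp add: p_def flip: sum_distrib_left)
  finally show ?thesis using k_real by simp
qed

text \<open>
  With \<open>m = k (1 - a) / a\<close> we have \<open>a p = (1 - g) / m\<close> and \<open>g \<ge> e\<^sup>-\<^sup>m\<close>, so the claim reduces to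
  a bound on \<open>e\<^sup>m\<close>; a bound uniform in \<open>k\<close> is needed here because \<open>a\<close> may tend to 1.
\<close>

lemma ap_minus_g_le_third: "a * p - g \<le> 1 / 3"
proof -
  define m where "m = real k * (1 - a) / a"
  have m: "0 < m" using a_pos a_lt_1 k_real by (simp add: m_def)
  have "a * p * m = real k * (1 - a) * p" using a_pos by (simp add: m_def)
  then have mp: "a * p * m = 1 - g" by (simp add: p_eq)
  have "3 - m \<le> g * (3 + 3 * m)"
  proof -
    have "1 / a = 1 + m / real k" using a_pos k_real by (simp add: m_def field_simps)
    also have "\<dots> \<le> exp (m / real k)" by (rule exp_ge_add_one_self)
    finally have "(1 / a) ^ k \<le> exp (m / real k) ^ k" using a_pos by (intro power_mono) auto
    also have "\<dots> = exp m" using k_real by (simp flip: exp_of_nat_mult)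
    finally have e: "1 \<le> g * exp m" using a_pos by (simp add: g_def field_simps)
    show ?thesis
    proof (cases "m \<le> 3")
      case True
      then have "1 * (3 - m) \<le> (g * exp m) * (3 - m)" using e by (intro mult_right_mono) auto
      also have "\<dots> = g * (exp m * (3 - m))" by simp
      also have "\<dots> \<le> g * (3 + 3 * m)"
        using exp_mult_3_minus_le m g_pos by (intro mult_left_mono) auto
      finally show ?thesis by simp
    next
      case False
      moreover have "0 \<le> g * (3 + 3 * m)" using g_pos m by simp
      ultimately show ?thesis by linarith
    qed
  qed
  then have "m * (a * p - g) \<le> m * (1 / 3)" using mp by (simp add: algebra_simps)
  then show ?thesis using m by (metis mult_le_cancel_left_pos)
qed

section \<open>The target rate, and the column sums for \<open>a \<le> 1/2\<close>\<close>

definition rate where "rate = max ((1 - 1 / real k) ^ k) ((1 - a / real k) ^ (2 * k))"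

text \<open>The largest eigenvalue of the block \<open>a I + (1 - a) 1 1\<^sup>T\<close>.\<close>

definition h where "h = a + real k * (1 - a)"

lemma D_pos: "0 < D" using a_pos a_lt_1 by (simp add: D_def)

lemma one_minus_D: "1 - D = 2 * a / (1 + a)"
  using a_pos by (simp add: D_def field_simps)

text \<open>The left-hand side is the [1/1] Pade approximant \<open>(1 - a - e) / (1 + a - e)\<close> of \<open>(1 - a/k)\<^sup>2\<^sup>k\<close>.\<close>

lemma rate_ge_small:
  assumes "e = a / (2 * real k)"
  shows "D - a\<^sup>2 / (real k * ((1 + a) * (1 + a - e))) \<le> rate"
proof -
  obtain m where m: "2 * k = Suc m" using k_ge_2 by (cases "2 * k") auto
  then have rm: "real m = 2 * real k - 1" by (metis add_diff_cancel_left' of_nat_Suc of_nat_mult of_nat_numeral)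
  have e: "0 < e" "e \<le> a / 4" "e * real k = a / 2"
  proof -
    show "0 < e" "e * real k = a / 2" using assms a_pos k_real by simp_all
    show "e \<le> a / 4" unfolding assms using a_pos k_real by (intro divide_left_mono) auto
  qed
  have "1 - (real m + 2) * (a / real k) / 2 \<le> (1 - a / real k) ^ Suc m * (1 + real m * (a / real k) / 2)"
    using a_pos a_lt_1 k_real by (intro one_minus_power_lower) auto
  moreover have "1 - (real m + 2) * (a / real k) / 2 = 1 - a - e"
    using k_real by (simp add: rm assms field_simps)
  moreover have "1 + real m * (a / real k) / 2 = 1 + a - e"
    using k_real by (simp add: rm assms field_simps)
  ultimately have le: "1 - a - e \<le> (1 - a / real k) ^ (2 * k) * (1 + a - e)"
    by (simp only: m)
  have pos: "0 < 1 + a - e" using e a_pos by linarith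
  have "D - a\<^sup>2 / (real k * ((1 + a) * (1 + a - e))) = (1 - a - e) / (1 + a - e)"
  proof -
    have a2: "a\<^sup>2 = 2 * a * e * real k" using e by (simp add: power2_eq_square)
    have *: "a\<^sup>2 / (real k * ((1 + a) * (1 + a - e))) = 2 * a * e / ((1 + a) * (1 + a - e))"
      unfolding a2 using k_real by simp
    have "D - 2 * a * e / ((1 + a) * (1 + a - e)) = ((1 - a) * (1 + a - e) - 2 * a * e) / ((1 + a) * (1 + a - e))"
      using pos a_pos by (simp add: D_def diff_divide_distrib)
    also have "(1 - a) * (1 + a - e) - 2 * a * e = (1 + a) * (1 - a - e)" by (simp add: algebra_simps)
    finally show ?thesis using a_pos by (simp add: *)
  qed
  also have "\<dots> \<le> (1 - a / real k) ^ (2 * k)"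
    using le pos by (simp add: pos_divide_le_eq)
  finally show ?thesis unfolding rate_def by simp
qed

lemma rate_ge_third: "1 / 3 - 1 / (12 * (real k - 1)) \<le> rate"
  using one_minus_inverse_power_lower[OF k_ge_2] unfolding rate_def by simp

text \<open>What remains of the numerator of \<open>column_sum1\<close> once
  \<open>(k - 1) * D - a\<^sup>2 / (1 + a)\<^sup>2\<close> has been charged to
  \<open>(k - 1) * rate\<close>. From \<open>k = 4\<close> on, \<open>V\<close> may be bounded by
  \<open>q\<close>; \<open>k = 2\<close> and \<open>k = 3\<close> are treated with explicit
  polynomials.\<close>

lemma column1_small_aux:
  assumes "a \<le> 1/2"
  shows "D + a\<^sup>2 * g\<^sup>2 / (1 + a)\<^sup>2 + (real k - 2) * (a\<^sup>2 * V) \<le> (1 - a * p)\<^sup>2"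
proof -
  consider "k = 2" | "k = 3" | "4 \<le> k" using k_ge_2 by linarith
  then show ?thesis
  proof cases
    case 1
    have pg: "p = (1 + a) / 2" "g = a\<^sup>2"
      unfolding p_def g_def unfolding 1 by (simp_all add: numeral_2_eq_2)
    have b: "a\<^sup>2 \<le> 1/4" "a^3 \<le> 1/8" "a^5 \<le> 1/32"
      using power_mono[OF assms, of 2] power_mono[OF assms, of 3] power_mono[OF assms, of 5] a_pos
      by (simp_all add: power_numeral_reduce)
    \<comment> \<open>For \<open>a \<le> 1/2\<close> one has \<open>a^5 \<le> 1/32\<close>,
      \<open>1 - a\<^sup>2 \<ge> 3/4\<close>, and the other factor is at least 1 - 3/8 - 1/4 - 1/32
      = 11/32, above 1/3.\<close>
    have "a * a^5 \<le> a * (3/4 * (1/3))" using b a_pos by (intro mult_left_mono) auto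
    also have "\<dots> \<le> a * ((1 - a\<^sup>2) * (1 - 3 * a / 4 - a\<^sup>2 - a^3 / 4))"
      using b assms a_pos by (intro mult_left_mono mult_mono) auto
    also have "\<dots> = a * ((1 - a\<^sup>2) * (4 - 3 * a - 4 * a\<^sup>2 - a^3)) / 4" by simp
    finally have "4 * (a * a^5) \<le> a * ((1 - a\<^sup>2) * (4 - 3 * a - 4 * a\<^sup>2 - a^3))" by linarith
    also have "\<dots> = ((1 - a\<^sup>2) * (2 + a))\<^sup>2 - 4 * (1 - a\<^sup>2)"
      by (simp add: power2_eq_square power3_eq_cube algebra_simps)
    also have "(1 - a\<^sup>2) * (2 + a) = 2 * ((1 - a\<^sup>2) * (1 + a / 2))"
      by (simp add: distrib_left)
    also have "\<dots>\<^sup>2 = 4 * ((1 - a\<^sup>2) * (1 + a / 2))\<^sup>2"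
      unfolding power_mult_distrib[of 2] by simp
    finally have "(1 - a\<^sup>2) + a^6 \<le> ((1 - a\<^sup>2) * (1 + a / 2))\<^sup>2"
      by (simp add: power_numeral_reduce)
    then have "((1 - a\<^sup>2) + a^6) / (1 + a)\<^sup>2 \<le> ((1 - a\<^sup>2) * (1 + a / 2))\<^sup>2 / (1 + a)\<^sup>2"
      by (intro divide_right_mono) auto
    moreover have "((1 - a\<^sup>2) + a^6) / (1 + a)\<^sup>2 = D + a\<^sup>2 * g\<^sup>2 / (1 + a)\<^sup>2"
    proof -
      have "(1 - a\<^sup>2) = (1 - a) * (1 + a)" by (simp add: power2_eq_square algebra_simps)
      then have "(1 - a\<^sup>2) / (1 + a)\<^sup>2 = D" using a_pos by (simp add: D_def power2_eq_square)
      moreover have "a^6 = a\<^sup>2 * g\<^sup>2" by (simp add: pg flip: power_mult power_add)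
      ultimately show ?thesis by (simp add: add_divide_distrib)
    qed
    moreover have "((1 - a\<^sup>2) * (1 + a / 2))\<^sup>2 / (1 + a)\<^sup>2 = (1 - a * p)\<^sup>2"
    proof -
      have "(1 - a\<^sup>2) * (1 + a / 2) = (1 + a) * (1 - a * p)"
        by (simp add: pg power2_eq_square field_simps)
      then show ?thesis using a_pos by (simp add: power_mult_distrib)
    qed
    ultimately show ?thesis using 1 by simp
  next
    case 2
    have pg: "p = (1 + a + a\<^sup>2) / 3" "g = a^3" "q = (1 + a\<^sup>2 + a^4) / 3"
      unfolding p_def q_def g_def unfolding 2 by (simp_all add: lessThan_nat_numeral)
    have V: "V = 2 * ((1 - a) * (1 - a^3)) / 9"
      by (simp add: V_def pg power2_eq_square power3_eq_cube power_numeral_reduce field_simps)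
    have "(1 - a) * (1 - a^3) \<le> 1"
      using a_pos a_lt_1 by (intro mult_le_one) (auto simp: power_le_one)
    then have Vle: "a\<^sup>2 * V \<le> a\<^sup>2 * (2/9)" unfolding V by (intro mult_left_mono) auto
    \<comment> \<open>These bounds make everything linear in \<open>a\<close>; it remains that 8/9 *
      1/2 + 2/3 * 1/4 + 1/128 is at most 4/3 - 2/3.\<close>
    have b: "a\<^sup>2 \<le> a * (1/2)" "a^3 \<le> a * (1/4)" "a^8 \<le> a * (1/128)"
    proof -
      show "a\<^sup>2 \<le> a * (1/2)" unfolding power2_eq_square using assms a_pos by (intro mult_left_mono) auto
      have "a * a^2 \<le> a * (1/2)^2" using assms a_pos by (intro mult_left_mono power_mono) auto
      then show "a^3 \<le> a * (1/4)" by (simp add: power_numeral_reduce)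
      have "a * a^7 \<le> a * (1/2)^7" using assms a_pos by (intro mult_left_mono power_mono) auto
      then show "a^8 \<le> a * (1/128)" by (simp add: power_numeral_reduce)
    qed
    have g8: "a\<^sup>2 * g\<^sup>2 / (1 + a)\<^sup>2 \<le> a^8"
    proof -
      have "a\<^sup>2 * g\<^sup>2 = a^8" by (simp add: pg flip: power_mult power_add)
      moreover have "a^8 / (1 + a)\<^sup>2 \<le> a^8 / 1" using a_pos by (intro divide_left_mono) auto
      ultimately show ?thesis by simp
    qed
    have "4 / 3 * a \<le> 2 * a / (1 + a)" 
      using a_pos assms by (simp add: field_simps)
    then have D: "D \<le> 1 - 4 / 3 * a" using one_minus_D by linarith
    have x: "a * p = (a + a\<^sup>2 + a^3) / 3" by (simp add: pg power2_eq_square power3_eq_cube algebra_simps)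
    have "(real k - 2) * (a\<^sup>2 * V) \<le> a\<^sup>2 * (2/9)" using Vle 2 by simp
    then have "D + a\<^sup>2 * g\<^sup>2 / (1 + a)\<^sup>2 + (real k - 2) * (a\<^sup>2 * V) \<le> (1 - 4/3 * a) + a^8 + a\<^sup>2 * (2/9)"
      using D g8 by (intro add_mono)
    also have "\<dots> \<le> 1 - 2 * (a * p)" unfolding x using b a_pos by argo
    also have "\<dots> \<le> (1 - a * p)\<^sup>2" by (simp add: power2_diff)
    finally show ?thesis .
  next
    case 3
    have kr: "4 \<le> real k" using 3 by simp
    have kd: "0 < real k * (1 - a)" using kr a_lt_1 by simp
    have "(real k - 2) * (a\<^sup>2 * V) \<le> (real k - 2) * (a\<^sup>2 * (1 / (real k * (1 - a\<^sup>2))))"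
      using kr q_le unfolding V_def by (intro mult_left_mono) (auto intro: order_trans[rotated])
    also have "\<dots> = (1 - 2 / real k) * a\<^sup>2 / (1 - a\<^sup>2)"
      using kr a2_lt by (simp add: field_simps)
    finally have 1: "(real k - 2) * (a\<^sup>2 * V) \<le> (1 - 2 / real k) * a\<^sup>2 / (1 - a\<^sup>2)" .
    have p: "p = (1 - g) / (real k * (1 - a))"
      unfolding p_eq[symmetric] using kr a_lt_1 by simp
    have x: "2 * (a * p) = 2 * a / (real k * (1 - a)) - 2 * a * g / (real k * (1 - a))"
      unfolding p by (simp add: field_simps diff_divide_distrib)
    \<comment> \<open>The \<open>g\<close> part of \<open>2 * (a * p)\<close> is to absorb the term
      with \<open>g\<^sup>2\<close>. This needs \<open>g\<close> to be at most
      \<open>1 / (k * (1 - a))\<close>, which follows from \<open>g \<le> p\<close>.\<close>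
    have "real k * (1 - a) * g \<le> 1"
    proof -
      have "g \<le> p" using ap_minus_g_nonneg a_lt_1 p_pos mult_left_le_one_le[of p a] a_pos by linarith
      then have "real k * (1 - a) * g \<le> real k * (1 - a) * p" using kd by (intro mult_left_mono) auto
      then show ?thesis using p_eq g_pos by linarith
    qed
    then have "(real k * (1 - a) * g) * (a\<^sup>2 * g) \<le> 1 * (a\<^sup>2 * g)"
      using g_pos by (intro mult_right_mono) auto
    also have "\<dots> \<le> 2 * a * g * (1 + a)\<^sup>2"
    proof -
      have "a * g * a \<le> a * g * (2 * (1 + a)\<^sup>2)"
        using a_pos g_pos by (intro mult_left_mono) (auto simp: power2_eq_square algebra_simps)
      then show ?thesis by (simp add: power2_eq_square algebra_simps)
    qed
    finally have *: "a\<^sup>2 * g\<^sup>2 * (real k * (1 - a)) \<le> 2 * a * g * (1 + a)\<^sup>2"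
      by (simp add: power2_eq_square mult_ac)
    then have 2: "a\<^sup>2 * g\<^sup>2 / (1 + a)\<^sup>2 \<le> 2 * a * g / (real k * (1 - a))"
    proof -
      have "0 < (1 + a)\<^sup>2" using a_pos by simp
      then have "a\<^sup>2 * g\<^sup>2 \<le> 2 * a * g * (1 + a)\<^sup>2 / (real k * (1 - a))"
        using * kd by (simp only: pos_le_divide_eq)
      then show ?thesis using \<open>0 < (1 + a)\<^sup>2\<close> by (simp add: pos_divide_le_eq)
    qed
    \<comment> \<open>Times \<open>(1 - a\<^sup>2) / a\<close> this reads
      \<open>2 / k + a \<le> 2 * (1 - a)\<close>, with equality at \<open>k = 4\<close> and
      \<open>a = 1/2\<close>.\<close>
    have 3: "(1 - 2 / real k) * a\<^sup>2 / (1 - a\<^sup>2) + 2 * a / (real k * (1 - a)) \<le> 2 * a / (1 + a)"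
    proof -
      have "2 / real k \<le> 1 / 2" using kr by (simp add: field_simps)
      then have "2 / real k + a \<le> 2 * (1 - a)" using assms by argo
      then have "a * (2 / real k + a) / (1 - a\<^sup>2) \<le> a * (2 * (1 - a)) / (1 - a\<^sup>2)"
        using a_pos a2_lt by (intro divide_right_mono mult_left_mono) auto
      also have "\<dots> = 2 * a / (1 + a)"
        using a_pos a_lt_1 a2_lt by (simp add: power2_eq_square frac_eq_eq algebra_simps)
      also have "a * (2 / real k + a) / (1 - a\<^sup>2) = (1 - 2 / real k) * a\<^sup>2 / (1 - a\<^sup>2) + 2 * a / (real k * (1 - a))"
      proof -
        have "2 * a / (real k * (1 - a)) = (2 / real k) * a * (1 + a) / (1 - a\<^sup>2)"
          using a_pos a_lt_1 a2_lt kr by (simp add: power2_eq_square frac_eq_eq algebra_simps)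
        moreover have "a * (2 / real k + a) = (1 - 2 / real k) * a\<^sup>2 + (2 / real k) * a * (1 + a)"
          by (simp add: power2_eq_square algebra_simps add_divide_distrib)
        ultimately show ?thesis by (simp only: add_divide_distrib)
      qed
      finally show ?thesis .
    qed
    have "1 - 2 * (a * p) \<le> (1 - a * p)\<^sup>2" by (simp add: power2_diff)
    with 1 2 3 x one_minus_D show ?thesis by argo
  qed
qed

text \<open>Equal to the later \<open>M11 + M21\<close>; the \<open>q\<close> that multiplies
  \<open>D\<close> there is eliminated through
  \<open>real k * D * q = (1 - g\<^sup>2) / (1 + a)\<^sup>2\<close>.\<close>

definition column_sum1 where
  "column_sum1 = (real k * D - a\<^sup>2 * (1 - g\<^sup>2) / (1 + a)\<^sup>2 - (1 - a * p)\<^sup>2 + (real k - 2) * (a\<^sup>2 * V))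
    / (real k - 1)"

definition column_sum2 where "column_sum2 = (a * p - g)\<^sup>2 + h\<^sup>2 * V / real k"

text \<open>The Pade error of \<open>rate_ge_small\<close>, times \<open>k - 1\<close>, is at most
  \<open>a\<^sup>2 / (1 + a)\<^sup>2\<close>, which the numerator of \<open>column_sum1\<close>
  supplies. This comes down to \<open>k * e = a / 2 \<le> 1 + a\<close>.\<close>

lemma column_sum1_le_small:
  assumes "a \<le> 1/2"
  shows "column_sum1 \<le> rate"
proof -
  define e where "e = a / (2 * real k)"
  have e: "0 < e" "e \<le> a" using a_pos k_real by (auto simp: e_def field_simps)
  define w where "w = 1 + a - e"
  have w: "0 < w" using e by (simp add: w_def)
  have "(real k - 1) * (1 + a) \<le> real k * w"
  proof -
    have "real k * e = a / 2" using k_real by (simp add: e_def)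
    then show ?thesis using a_pos by (simp add: w_def algebra_simps)
  qed
  then have kw: "a\<^sup>2 * ((real k - 1) * (1 + a)) \<le> a\<^sup>2 * (real k * w)" by (intro mult_left_mono) auto
  have "(real k - 1) * (a\<^sup>2 / (real k * ((1 + a) * w))) \<le> a\<^sup>2 / (1 + a)\<^sup>2"
  proof -
    have pos: "0 < real k * ((1 + a) * w)" "0 < (1 + a)\<^sup>2" using a_pos k_real w by simp_all
    have "(real k - 1) * a\<^sup>2 * (1 + a)\<^sup>2 = (a\<^sup>2 * ((real k - 1) * (1 + a))) * (1 + a)"
      by (simp add: power2_eq_square mult_ac)
    also have "\<dots> \<le> (a\<^sup>2 * (real k * w)) * (1 + a)" using kw a_pos by (intro mult_right_mono) auto
    also have "\<dots> = a\<^sup>2 * (real k * ((1 + a) * w))" by (simp add: mult_ac)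
    finally have "(real k - 1) * a\<^sup>2 \<le> a\<^sup>2 * (real k * ((1 + a) * w)) / (1 + a)\<^sup>2"
      using pos by (simp only: pos_le_divide_eq)
    then show ?thesis using pos by (simp add: pos_divide_le_eq)
  qed
  moreover have "(real k - 1) * (D - a\<^sup>2 / (real k * ((1 + a) * w))) \<le> (real k - 1) * rate"
    using rate_ge_small[OF e_def] k_real by (intro mult_left_mono) (auto simp: w_def)
  ultimately have "(real k - 1) * D - a\<^sup>2 / (1 + a)\<^sup>2 \<le> (real k - 1) * rate"
    by (simp add: algebra_simps)
  moreover have "a\<^sup>2 * (1 - g\<^sup>2) / (1 + a)\<^sup>2 = a\<^sup>2 / (1 + a)\<^sup>2 - a\<^sup>2 * g\<^sup>2 / (1 + a)\<^sup>2"
    by (simp add: right_diff_distrib diff_divide_distrib)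
  moreover have "real k * D = (real k - 1) * D + D" by (simp add: algebra_simps)
  ultimately have "real k * D - a\<^sup>2 * (1 - g\<^sup>2) / (1 + a)\<^sup>2 - (1 - a * p)\<^sup>2 + (real k - 2) * (a\<^sup>2 * V)
      \<le> (real k - 1) * rate"
    using column1_small_aux[OF assms] by argo
  then show ?thesis using k_real unfolding column_sum1_def by (simp add: pos_divide_le_eq mult.commute)
qed

text \<open>Splits \<open>h\<^sup>2 * V\<close> into \<open>h\<^sup>2 * q - (h * p)\<^sup>2\<close>.
  The geometric sums turn \<open>h * p\<close> into \<open>1 + (a * p - g)\<close> and bring out the
  leading term \<open>real k * D\<close>.\<close>

lemma column_sum2_eq:
  "real k * column_sum2 = real k * D * (1 - g\<^sup>2) + 2 * a * (1 - g\<^sup>2) / (1 + a) + a\<^sup>2 * q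
    - (1 + (a * p - g))\<^sup>2 + real k * (a * p - g)\<^sup>2"
proof -
  have hp: "h * p = 1 + (a * p - g)" using p_eq by (simp add: h_def algebra_simps)
  have kq: "real k * (1 - a) * q = (1 - g\<^sup>2) / (1 + a)"
    using q_eq a_pos by (simp add: field_simps power2_eq_square)
  have "h\<^sup>2 * q = a\<^sup>2 * q + 2 * a * (real k * (1 - a) * q) + real k * (1 - a) * (real k * (1 - a) * q)"
    by (simp add: h_def power2_eq_square algebra_simps)
  also have "\<dots> = a\<^sup>2 * q + 2 * a * (1 - g\<^sup>2) / (1 + a) + real k * D * (1 - g\<^sup>2)"
    unfolding kq D_def by simp
  finally have hq: "h\<^sup>2 * q = a\<^sup>2 * q + 2 * a * (1 - g\<^sup>2) / (1 + a) + real k * D * (1 - g\<^sup>2)" .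
  have "real k * column_sum2 = real k * (a * p - g)\<^sup>2 + h\<^sup>2 * V"
    using k_real by (simp add: column_sum2_def distrib_left)
  also have "h\<^sup>2 * V = h\<^sup>2 * q - (h * p)\<^sup>2" by (simp add: V_def right_diff_distrib power_mult_distrib)
  finally show ?thesis unfolding hq hp by argo
qed

lemma column_sum2_mult_le:
  "real k * column_sum2 \<le> real k * D + 2 * a / (1 + a) + a\<^sup>2 * q
    + ((real k - 1) * (a * p - g)\<^sup>2 - 2 * (a * p - g)) - 1"
proof -
  have "real k * D * (1 - g\<^sup>2) \<le> real k * D * 1" 
    using D_pos k_real by (intro mult_left_mono) auto
  moreover have "2 * a * (1 - g\<^sup>2) / (1 + a) \<le> 2 * a * 1 / (1 + a)"
    using a_pos by (intro divide_right_mono mult_left_mono) auto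
  moreover have "(1 + (a * p - g))\<^sup>2 = 1 + 2 * (a * p - g) + (a * p - g)\<^sup>2" 
    by (simp add: power2_eq_square algebra_simps)
  moreover have "(real k - 1) * (a * p - g)\<^sup>2 = real k * (a * p - g)\<^sup>2 - (a * p - g)\<^sup>2"
    by (simp add: algebra_simps)
  ultimately show ?thesis unfolding column_sum2_eq by argo
qed

text \<open>Since \<open>k * (a * p) \<le> a / (1 - a) \<le> 2\<close>, the quadratic
  \<open>(k - 1) * y\<^sup>2 - 2 * y\<close> is not positive at
  \<open>y = a * p - g\<close>.\<close>

lemma column_sum2_mult_le':
  assumes "a \<le> 2/3"
  shows "real k * column_sum2 \<le> real k * D + 2 * a / (1 + a) + a\<^sup>2 * q - 1"
proof -
  have kd: "0 < real k * (1 - a)" using a_lt_1 k_real by simp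
  have "a * p \<le> a * (1 / (real k * (1 - a)))" using p_le a_pos by (intro mult_left_mono) auto
  also have "\<dots> = a / (1 - a) / real k" by simp
  also have "\<dots> \<le> 2 / real k"
    using assms a_lt_1 k_real by (intro divide_right_mono) (auto simp: divide_le_eq)
  finally have "real k * (a * p) \<le> 2" using k_real by (simp add: field_simps)
  moreover have "real k * (a * p - g) \<le> real k * (a * p)" using g_pos by (intro mult_left_mono) auto
  ultimately have "real k * (a * p - g) \<le> 2" by linarith
  then have "(real k - 1) * (a * p - g) \<le> 2" using ap_minus_g_nonneg by (simp add: left_diff_distrib)
  then have "(real k - 1) * (a * p - g) * (a * p - g) \<le> 2 * (a * p - g)"
    using ap_minus_g_nonneg by (intro mult_right_mono) auto
  then have "(real k - 1) * (a * p - g)\<^sup>2 - 2 * (a * p - g) \<le> 0" by (simp add: power2_eq_square)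
  then show ?thesis using column_sum2_mult_le by linarith
qed

lemma column_sum2_le_small:
  assumes "a \<le> 1/2"
  shows "column_sum2 \<le> rate"
proof -
  define e where "e = a / (2 * real k)"
  have e: "0 < e" "e \<le> a / 4"
  proof -
    show "0 < e" unfolding e_def using a_pos k_real by simp
    show "e \<le> a / 4" unfolding e_def using a_pos k_real by (intro divide_left_mono) auto
  qed
  have a2: "a\<^sup>2 \<le> 1/4" using power_mono[OF assms, of 2] a_pos by (simp add: power2_eq_square)
  have "a * a \<le> 1/2 * a" using assms a_pos by (intro mult_right_mono) auto
  then have "a\<^sup>2 \<le> 1/2 * a" by (simp add: power2_eq_square)
  \<comment> \<open>The 1 subtracted in \<open>column_sum2_mult_le'\<close> is spent as 2/3 + 1/6 +
    1/6: on this term, on \<open>a\<^sup>2 * q\<close>, and on \<open>k\<close> times the Pade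
    error.\<close>
  have "2 * a / (1 + a) \<le> 2/3" using assms a_pos by (simp add: divide_le_eq)
  moreover have "a\<^sup>2 * q \<le> 1/6"
  proof -
    have "(1/4) * q \<le> 1/6"
    proof -
      have "real k * (1 - a\<^sup>2) \<ge> 2 * (3/4)" using k_real a2 by (intro mult_mono) auto
      then have "1 / (real k * (1 - a\<^sup>2)) \<le> 1 / (2 * (3/4))" by (intro divide_left_mono) auto
      then show ?thesis using q_le by simp
    qed
    then show ?thesis using a2 q_pos mult_right_mono[of "a\<^sup>2" "1/4" q] by linarith
  qed
  moreover have "a\<^sup>2 / ((1 + a) * (1 + a - e)) \<le> 1/6"
  proof -
    have "(1 + a) * (1 + 3 * a / 4) \<le> (1 + a) * (1 + a - e)"
      using e a_pos by (intro mult_left_mono) auto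
    moreover have "(1 + a) * (1 + 3 * a / 4) = 1 + 7/4 * a + 3/4 * a\<^sup>2"
      by (simp add: field_simps power2_eq_square)
    then have "6 * a\<^sup>2 \<le> (1 + a) * (1 + 3 * a / 4)"
      using a2 \<open>a\<^sup>2 \<le> 1/2 * a\<close> by argo
    moreover have "0 < (1 + a) * (1 + a - e)" using e a_pos by simp
    ultimately show ?thesis by (simp add: pos_divide_le_eq)
  qed
  moreover have "real k * (D - a\<^sup>2 / (real k * ((1 + a) * (1 + a - e)))) \<le> real k * rate"
    using rate_ge_small[OF e_def] k_real by (intro mult_left_mono) auto
  moreover have "real k * (D - a\<^sup>2 / (real k * ((1 + a) * (1 + a - e)))) 
      = real k * D - a\<^sup>2 / ((1 + a) * (1 + a - e))"
  proof -
    have "real k * (x - y / (real k * z)) = real k * x - y / z" for x y z :: real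
      using k_real by (simp add: right_diff_distrib)
    then show ?thesis .
  qed
  moreover have "real k * column_sum2 \<le> real k * D + 2 * a / (1 + a) + a\<^sup>2 * q - 1"
    using assms by (intro column_sum2_mult_le') auto
  ultimately have "real k * column_sum2 \<le> real k * rate" by argo
  then show ?thesis using k_real by simp
qed

section \<open>The column sums for \<open>a \<ge> 1/2\<close>\<close>

lemma D_le_third: 
  assumes "1/2 \<le> a"
  shows "D \<le> 1/3"
  using assms unfolding D_def by (simp add: divide_le_eq)

lemma one_minus_ap_ge: "(1 - a) * (2 + a) / 2 \<le> 1 - a * p"
proof -
  have "a * p \<le> a * ((1 + a) / 2)" using p_le_half a_pos by (intro mult_left_mono) auto
  then show ?thesis by (simp add: field_simps)
qed

text \<open>For \<open>a \<ge> 3/5\<close> each of the \<open>k - 2\<close> copies of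
  \<open>D + a\<^sup>2 * V\<close> is at most 1/3 and the rest at most 1/4. At
  \<open>a = 1/2\<close> already \<open>D = 1/3\<close>, so below 3/5 the negative term with
  \<open>1 - g\<^sup>2\<close>, dropped in the first case, has to be kept; \<open>k = 2\<close> has
  no copies and is separate.\<close>

lemma column_sum1_le_large:
  assumes "1/2 \<le> a"
  shows "column_sum1 \<le> rate"
proof -
  have g2: "g\<^sup>2 \<le> 1" using g_pos g_lt_1 by (simp add: power_le_one)
  have k2: "real k - 2 \<ge> 0" using k_real by simp
  have t: "0 \<le> a\<^sup>2 * (1 - g\<^sup>2) / (1 + a)\<^sup>2" using g2 by simp
  have sq: "((1 - a) * (2 + a) / 2)\<^sup>2 \<le> (1 - a * p)\<^sup>2"
    using one_minus_ap_ge a_pos a_lt_1 by (intro power_mono) auto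
  have third: "a\<^sup>2 * (1 - g\<^sup>2) / (1 + a)\<^sup>2 \<ge> (1 - g\<^sup>2) / 9"
  proof -
    have "1/3 \<le> a / (1 + a)" using assms a_pos by (simp add: le_divide_eq)
    then have "(1/3)\<^sup>2 \<le> (a / (1 + a))\<^sup>2" by (intro power_mono) auto
    then have "(1 - g\<^sup>2) * (1/9) \<le> (1 - g\<^sup>2) * (a / (1 + a))\<^sup>2"
      using g2 by (intro mult_left_mono) (auto simp: power_divide)
    then show ?thesis by (simp add: power_divide mult.commute)
  qed
  have kD: "real k * D = (real k - 2) * D + 2 * D" by (simp add: algebra_simps)
  have main: "real k * D - a\<^sup>2 * (1 - g\<^sup>2) / (1 + a)\<^sup>2 - (1 - a * p)\<^sup>2 + (real k - 2) * (a\<^sup>2 * V)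
      \<le> (real k - 2) / 3 + 1/4"
  proof -
    consider "3/5 \<le> a" | "k = 2" "a \<le> 3/5" | "3 \<le> k" "a \<le> 3/5" using k_ge_2 by linarith
    then show ?thesis
    proof cases
      case 1
      have "D + a\<^sup>2 * V \<le> 1/3"
      proof -
        have "(1 + g) / (1 + a) \<le> (1 + a\<^sup>2) / (1 + a)"
          using g_le a_pos by (intro divide_right_mono) auto
        then have "((1 + g) / (1 + a))\<^sup>2 \<le> ((1 + a\<^sup>2) / (1 + a))\<^sup>2"
          using g_pos a_pos by (intro power_mono) auto
        then have "V \<le> ((1 + a\<^sup>2) / (1 + a))\<^sup>2 / 4" using V_le by linarith
        then have "a\<^sup>2 * V \<le> a\<^sup>2 * (((1 + a\<^sup>2) / (1 + a))\<^sup>2 / 4)" by (intro mult_left_mono) auto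
        also have "\<dots> = (a\<^sup>2 * (1 + a\<^sup>2)\<^sup>2 / 4) / (1 + a)\<^sup>2" by (simp add: power_divide)
        finally have "D + a\<^sup>2 * V \<le> ((1 - a) * (1 + a) + a\<^sup>2 * (1 + a\<^sup>2)\<^sup>2 / 4) / (1 + a)\<^sup>2"
          using a_pos by (simp add: D_def power2_eq_square add_divide_distrib)
        also have "\<dots> \<le> 1/3"
        proof -
          define w where "w = a\<^sup>2"
          have w: "9/25 \<le> w" "w \<le> 1" using power_mono[OF 1, of 2] a2_lt
            by (simp_all add: w_def power2_eq_square)
          \<comment> \<open>The chord of \<open>w * w\<close> over the interval from 9/25 to 1.
            Together with \<open>w * w * w \<le> w * w\<close> it makes the polynomial inequality
            linear in \<open>w\<close> and \<open>a\<close>.\<close>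
          have "(w - 9/25) * (w - 1) \<le> 0" using w by (intro mult_nonneg_nonpos) auto
          moreover have "(w - 9/25) * (w - 1) = w * w - 34/25 * w + 9/25" by (simp add: field_simps)
          ultimately have 1: "w * w \<le> 34/25 * w - 9/25" by argo
          have "w * w * w \<le> w * w * 1" using w by (intro mult_left_mono) auto
          then have "12 * (1 - w) + 3 * (w + 2 * (w * w) + w * w * w) \<le> 4 * (1 + 2 * a + w)"
            using 1 w \<open>3/5 \<le> a\<close> by argo
          moreover have "(1 - a) * (1 + a) = 1 - w" "(1 + a)\<^sup>2 = 1 + 2 * a + w"
              "a\<^sup>2 * (1 + a\<^sup>2)\<^sup>2 = w + 2 * (w * w) + w * w * w"
            by (simp_all add: w_def power2_eq_square algebra_simps)
          ultimately have "((1 - a) * (1 + a) + a\<^sup>2 * (1 + a\<^sup>2)\<^sup>2 / 4) \<le> (1 + a)\<^sup>2 / 3"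
            by argo
          then show ?thesis using a_pos by (simp add: divide_le_eq)
        qed
        finally show ?thesis .
      qed
      then have "(real k - 2) * (D + a\<^sup>2 * V) \<le> (real k - 2) * (1/3)" using k2 by (intro mult_left_mono)
      moreover have "2 * D - ((1 - a) * (2 + a) / 2)\<^sup>2 \<le> 1/4"
      proof -
        define d where "d = 1 - a"
        \<comment> \<open>The product is 1352/125, rounded down to 54/5; the square below completes
          \<open>54/5 * d\<^sup>2 - 9 * d\<close>.\<close>
        have "(13/5)\<^sup>2 * (8/5) \<le> (2 + a)\<^sup>2 * (1 + a)" using 1 by (intro mult_mono power_mono) auto
        then have "54/5 * d\<^sup>2 \<le> ((2 + a)\<^sup>2 * (1 + a)) * d\<^sup>2"
          by (intro mult_right_mono) (auto simp: power2_eq_square)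
        moreover have "0 \<le> (54/5 * d - 9/2)\<^sup>2" by simp
        moreover have "(54/5 * d - 9/2)\<^sup>2 = 2916/25 * d\<^sup>2 - 486/5 * d + 81/4"
          by (simp add: power2_eq_square field_simps)
        ultimately have "9 * d - 2 \<le> ((2 + a)\<^sup>2 * (1 + a)) * d\<^sup>2"
          by argo
        moreover have "(1/4 + (d * (2 + a) / 2)\<^sup>2) * (1 + a) = (2 - d) / 4 + ((2 + a)\<^sup>2 * (1 + a)) * d\<^sup>2 / 4"
          by (simp add: d_def power_mult_distrib power_divide distrib_right)
        ultimately have "2 * d \<le> (1/4 + (d * (2 + a) / 2)\<^sup>2) * (1 + a)" by argo
        then have "2 * d / (1 + a) \<le> 1/4 + (d * (2 + a) / 2)\<^sup>2"
          using a_pos by (simp add: pos_divide_le_eq)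
        moreover have "2 * D = 2 * d / (1 + a)" by (simp add: D_def d_def)
        ultimately show ?thesis unfolding d_def by argo
      qed
      moreover have "(real k - 2) * (D + a\<^sup>2 * V) = (real k - 2) * D + (real k - 2) * (a\<^sup>2 * V)"
        by (rule distrib_left)
      ultimately show ?thesis using t sq kD by argo
    next
      case 2
      have "g \<le> (3/5)\<^sup>2" using g_le power_mono[OF 2(2), of 2] a_pos by linarith
      then have "g\<^sup>2 \<le> ((3/5)\<^sup>2)\<^sup>2" using g_pos by (intro power_mono) auto
      then have g: "g\<^sup>2 \<le> 13/100" by (simp add: power2_eq_square)
      \<comment> \<open>87/900 is \<open>(1 - 13/100) / 9\<close>, the contribution of
        \<open>third\<close> under the bound on \<open>g\<^sup>2\<close>.\<close>
      have "2 * D - ((1 - a) * (2 + a) / 2)\<^sup>2 \<le> 1/4 + 87/900"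
      proof -
        define d where "d = 1 - a"
        have d: "2/5 \<le> d" "d \<le> 1/2" using 2 assms by (auto simp: d_def)
        have "(5/2)\<^sup>2 \<le> (2 + a)\<^sup>2" using assms by (intro power_mono) auto
        then have "(25/4) * d\<^sup>2 \<le> (2 + a)\<^sup>2 * d\<^sup>2"
          by (intro mult_right_mono) (auto simp: power2_eq_square)
        \<comment> \<open>The tangent of \<open>d\<^sup>2\<close> at 9/20, the midpoint of the range
          of \<open>d\<close>.\<close>
        moreover have "0 \<le> (d - 9/20)\<^sup>2" by simp
        moreover have "(d - 9/20)\<^sup>2 = d\<^sup>2 - 9/10 * d + 81/400" by (simp add: power2_eq_square field_simps)
        moreover have "(d * (2 + a) / 2)\<^sup>2 = (2 + a)\<^sup>2 * d\<^sup>2 / 4"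
          by (simp add: power_mult_distrib power_divide)
        ultimately have "25/16 * (9/10 * d - 81/400) \<le> (d * (2 + a) / 2)\<^sup>2" by argo
        moreover have "2 * D \<le> 4/3 * d"
        proof -
          have "2 * D = 2 * d / (1 + a)" by (simp add: D_def d_def)
          also have "\<dots> \<le> 2 * d / (3/2)" using assms d by (intro divide_left_mono) auto
          finally show ?thesis by simp
        qed
        ultimately have "2 * D - (d * (2 + a) / 2)\<^sup>2 \<le> 1/4 + 87/900" using d by argo
        then show ?thesis by (simp only: d_def)
      qed
      then show ?thesis using sq third g 2(1) by simp
    next
      case 3
      have kr: "3 \<le> real k" using 3 by simp
      have "g \<le> a^3" unfolding g_def using a_pos a_lt_1 3 by (intro power_decreasing) auto
      also have "\<dots> \<le> (3/5)^3" using a_pos 3 by (intro power_mono) auto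
      finally have "g\<^sup>2 \<le> ((3/5)^3)\<^sup>2" using g_pos by (intro power_mono) auto
      then have g: "g\<^sup>2 \<le> 47/1000" by (simp add: power_numeral_reduce)
      have D: "(real k - 2) * D \<le> (real k - 2) * (1/3)" "2 * D \<le> 2/3"
        using D_le_third[OF assms] mult_left_mono[OF D_le_third[OF assms] k2] by simp_all
      have a2: "a\<^sup>2 \<le> 9/25" using power_mono[OF 3(2), of 2] a_pos by (simp add: power2_eq_square)
      have q: "(real k - 2) * (a\<^sup>2 * q) \<le> (1 - 2 / real k) * (9/16)"
      proof -
        have "a\<^sup>2 * q \<le> a\<^sup>2 * (1 / (real k * (1 - a\<^sup>2)))" using q_le by (intro mult_left_mono) auto
        also have "\<dots> = a\<^sup>2 / (1 - a\<^sup>2) / real k" by simp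
        also have "\<dots> \<le> 9/16 / real k"
          using a2 a2_lt kr by (intro divide_right_mono) (auto simp: pos_divide_le_eq)
        finally have "(real k - 2) * (a\<^sup>2 * q) \<le> (real k - 2) * (9/16 / real k)"
          using k2 by (intro mult_left_mono) auto
        also have "\<dots> = (1 - 2 / real k) * (9/16)" using kr by (simp add: field_simps)
        finally show ?thesis .
      qed
      have V: "(real k - 2) * (a\<^sup>2 * V) = (real k - 2) * (a\<^sup>2 * q) - (real k - 2) * (a * p)\<^sup>2"
        by (simp add: V_def power_mult_distrib algebra_simps)
      have x: "2 * (a * p) - (real k - 1) * (a * p)\<^sup>2 \<le> 1 / (real k - 1)"
      proof -
        define z where "z = real k - 1"
        have z: "0 < z" using kr by (simp add: z_def)
        have "0 \<le> (1 - z * (a * p))\<^sup>2" by simp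
        then have "z * (2 * (a * p) - z * (a * p)\<^sup>2) \<le> 1" by (simp add: power2_eq_square algebra_simps)
        then show ?thesis unfolding z_def[symmetric] using z by (simp add: pos_le_divide_eq mult.commute)
      qed
      \<comment> \<open>6892/10000 is the remaining budget 1/4 + 1 - 2/3 + (1 - 47/1000)/9, rounded
        down.\<close>
      have num: "(1 - 2 / real k) * (9/16) + 1 / (real k - 1) \<le> 6892/10000"
      proof -
        define z where "z = real k"
        have z: "3 \<le> z" using kr by (simp add: z_def)
        have "3 * z \<le> z * z" using z by (intro mult_right_mono) auto
        then have "(z - 2) * (z - 1) * (9/16) + z \<le> 6892/10000 * (z * (z - 1))"
        proof -
          have "(z - 2) * (z - 1) = z * z - 3 * z + 2" "z * (z - 1) = z * z - z"
            by (simp_all add: algebra_simps)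
          then show ?thesis using z \<open>3 * z \<le> z * z\<close> by argo
        qed
        moreover have "(1 - 2 / z) * (9/16) + 1 / (z - 1) = ((z - 2) * (z - 1) * (9/16) + z) / (z * (z - 1))"
          using z by (simp add: field_simps)
        ultimately show ?thesis unfolding z_def[symmetric] using z by (simp add: pos_divide_le_eq)
      qed
      have "(1 - a * p)\<^sup>2 = 1 - 2 * (a * p) + (a * p)\<^sup>2" by (simp add: power2_diff)
      moreover have "(real k - 1) * (a * p)\<^sup>2 = (real k - 2) * (a * p)\<^sup>2 + (a * p)\<^sup>2"
        by (simp add: algebra_simps)
      ultimately show ?thesis using D q x num third g kD unfolding V by argo
    qed
  qed
  also have "\<dots> = (real k - 1) * (1 / 3 - 1 / (12 * (real k - 1)))"
    using k_real by (simp add: field_simps)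
  also have "\<dots> \<le> (real k - 1) * rate"
    using rate_ge_third k_real by (intro mult_left_mono) auto
  finally show ?thesis using k_real unfolding column_sum1_def by (simp add: pos_divide_le_eq mult.commute)
qed

text \<open>Times \<open>k\<close> the target is at least \<open>k/3 - 1/6\<close>. Up to
  \<open>a = 2/3\<close> the quadratic in \<open>a * p - g\<close> is dropped by
  \<open>column_sum2_mult_le'\<close>; beyond, \<open>k * (a * p - g)\<close> is no longer bounded
  uniformly in \<open>k\<close>, and \<open>ap_minus_g_le_third\<close> takes over.\<close>

lemma column_sum2_le_large:
  assumes "1/2 \<le> a"
  shows "column_sum2 \<le> rate"
proof -
  define d where "d = 1 - a"
  have d: "0 < d" "d \<le> 1/2" using assms a_lt_1 by (auto simp: d_def)
  have ad: "a * d \<le> 1/4"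
  proof -
    have "0 \<le> (a - 1/2)\<^sup>2" by simp
    then show ?thesis by (simp add: d_def power2_eq_square field_simps)
  qed
  have k_rate: "real k / 3 - 1/6 \<le> real k * rate"
  proof -
    have "real k / (12 * (real k - 1)) \<le> 1/6" using k_real by (simp add: divide_le_eq)
    then have "real k / 3 - 1/6 \<le> real k * (1 / 3 - 1 / (12 * (real k - 1)))"
      by (simp add: right_diff_distrib)
    also have "\<dots> \<le> real k * rate" using rate_ge_third by (intro mult_left_mono) auto
    finally show ?thesis .
  qed
  consider "k = 2" | "k = 3" | "4 \<le> k" "a \<le> 2/3" | "4 \<le> k" "2/3 \<le> a"
    using k_ge_2 by linarith
  then show ?thesis
  proof cases
    case 1
    then have kr: "real k = 2" by simp
    have pg: "p = (1 + a) / 2" "g = a\<^sup>2" "q = (1 + a\<^sup>2) / 2"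
      unfolding p_def g_def q_def unfolding 1 by (simp_all add: numeral_2_eq_2)
    have "V = d\<^sup>2 / 4" by (simp add: V_def pg d_def power2_eq_square field_simps)
    moreover have "h = 1 + d" by (simp add: h_def d_def kr)
    moreover have "a * p - g = a * d / 2" by (simp add: pg d_def power2_eq_square field_simps)
    ultimately have "column_sum2 = (a * d)\<^sup>2 / 4 + (d * (1 + d))\<^sup>2 / 8"
      by (simp only: column_sum2_def kr) (simp add: power_mult_distrib power_divide)
    moreover have "(a * d)\<^sup>2 \<le> (1/4)\<^sup>2" using ad a_pos d by (intro power_mono) auto
    moreover have "d * (1 + d) \<le> 1/2 * (3/2)" using d by (intro mult_mono) auto
    then have "(d * (1 + d))\<^sup>2 \<le> (3/4)\<^sup>2" using d by (intro power_mono) auto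
    moreover have "(1/4)\<^sup>2 = (1/16 :: real)" "(3/4)\<^sup>2 = (9/16 :: real)" by (simp_all add: power2_eq_square)
    ultimately have "column_sum2 \<le> 1/4" by argo
    also have "\<dots> \<le> rate" using k_rate by (simp add: kr)
    finally show ?thesis .
  next
    case 2
    then have kr: "real k = 3" by simp
    have pg: "p = (1 + a + a\<^sup>2) / 3" "g = a^3" "q = (1 + a\<^sup>2 + a^4) / 3"
      unfolding p_def q_def g_def unfolding 2 by (simp_all add: lessThan_nat_numeral)
    have "V = 2 * (d\<^sup>2 * (1 + a + a\<^sup>2)) / 9"
      by (simp add: V_def pg d_def power2_eq_square power3_eq_cube power_numeral_reduce field_simps)
    moreover have "h = 1 + 2 * d" by (simp add: h_def d_def kr)
    moreover have "a * p - g = (a * d) * ((1 + 2 * a) / 3)"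
      by (simp add: pg d_def power2_eq_square power3_eq_cube field_simps)
    ultimately have "column_sum2 = ((a * d) * ((1 + 2 * a) / 3))\<^sup>2 + (d * (1 + 2 * d))\<^sup>2 * (1 + a + a\<^sup>2) * (2 / 27)"
      by (simp only: column_sum2_def kr) (simp add: power_mult_distrib)
    also have "\<dots> \<le> (1/4)\<^sup>2 + 1\<^sup>2 * 3 * (2 / 27)"
    proof (intro add_mono mult_right_mono mult_mono power_mono)
      have "(a * d) * ((1 + 2 * a) / 3) \<le> 1/4 * 1"
        using ad a_pos a_lt_1 d by (intro mult_mono) auto
      then show "(a * d) * ((1 + 2 * a) / 3) \<le> 1/4" by simp
      have "d * (1 + 2 * d) \<le> 1/2 * 2" using d by (intro mult_mono) auto
      then show "d * (1 + 2 * d) \<le> 1" by simp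
      show "1 + a + a\<^sup>2 \<le> 3" using a_lt_1 a2_lt by linarith
    qed (use a_pos d in auto)
    also have "\<dots> \<le> 7/24" by (simp add: power2_eq_square)
    also have "\<dots> \<le> rate" using rate_ge_third by (simp add: kr)
    finally show ?thesis .
  next
    case 3
    have kr: "4 \<le> real k" using 3 by simp
    have "(real k - 4) * D \<le> (real k - 4) * (1/3)"
      using kr D_le_third[OF assms] by (intro mult_left_mono) auto
    \<comment> \<open>\<open>2 * a / (1 + a) = 1 - D\<close> cancels the -1 and one
      \<open>D\<close>. Of the remaining \<open>k - 1\<close> copies, \<open>k - 4\<close> cost 1/3
      each, which leaves exactly 7/6 of \<open>k/3 - 1/6\<close>.\<close>
    moreover have "3 * D + a\<^sup>2 * q \<le> 7/6"
    proof -
      have "4 * (1 - a\<^sup>2) \<le> real k * (1 - a\<^sup>2)" using kr a2_lt by (intro mult_right_mono) auto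
      then have "1 / (real k * (1 - a\<^sup>2)) \<le> 1 / (4 * (1 - a\<^sup>2))"
        using a2_lt kr by (intro divide_left_mono) auto
      then have "a\<^sup>2 * q \<le> a\<^sup>2 * (1 / (4 * (1 - a\<^sup>2)))"
        using q_le by (intro mult_left_mono) auto
      moreover have "3 * D = 12 * (1 - a)\<^sup>2 / (4 * (1 - a\<^sup>2))"
      proof -
        have "1 - a\<^sup>2 = (1 - a) * (1 + a)" by (simp add: power2_eq_square algebra_simps)
        then have "D = (1 - a)\<^sup>2 / (1 - a\<^sup>2)" using a_lt_1 by (simp add: D_def power2_eq_square)
        moreover have "3 * (x / y) = 12 * x / (4 * y)" for x y :: real by simp
        ultimately show ?thesis by (simp only:)
      qed
      ultimately have "3 * D + a\<^sup>2 * q \<le> (12 * (1 - a)\<^sup>2 + a\<^sup>2) / (4 * (1 - a\<^sup>2))"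
        by (simp add: add_divide_distrib)
      also have "\<dots> \<le> 7/6"
      proof -
        have "(a - 1/2) * (a - 2/3) \<le> 0" using 3 assms by (intro mult_nonneg_nonpos) auto
        moreover have "(a - 1/2) * (a - 2/3) = a\<^sup>2 - 7/6 * a + 1/3"
          by (simp add: power2_eq_square field_simps)
        moreover have "(1 - a)\<^sup>2 = 1 - 2 * a + a\<^sup>2" by (simp add: power2_diff)
        ultimately have "12 * (1 - a)\<^sup>2 + a\<^sup>2 \<le> 7/6 * (4 * (1 - a\<^sup>2))" using assms by argo
        then show ?thesis using a2_lt by (simp add: pos_divide_le_eq)
      qed
      finally show ?thesis .
    qed
    moreover have "real k * column_sum2 \<le> real k * D + 2 * a / (1 + a) + a\<^sup>2 * q - 1"
      using 3 by (intro column_sum2_mult_le')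
    moreover have "real k * D = (real k - 4) * D + 4 * D" by (simp add: algebra_simps)
    ultimately have "real k * column_sum2 \<le> real k * rate" using one_minus_D k_rate by argo
    then show ?thesis using kr by simp
  next
    case 4
    have kr: "4 \<le> real k" using 4 by simp
    define y where "y = a * p - g"
    have y: "0 \<le> y" "y \<le> 1/3" using ap_minus_g_nonneg ap_minus_g_le_third by (auto simp: y_def)
    have d3: "d \<le> 1/3" using 4 by (simp add: d_def)
    have D: "D \<le> 3/5 * d"
    proof -
      have "D = d / (1 + a)" by (simp add: D_def d_def)
      also have "\<dots> \<le> d / (5/3)" using d 4 by (intro divide_left_mono) auto
      finally show ?thesis by simp
    qed
    have aq: "a\<^sup>2 * q \<le> 1 - 5/3 * d"
    proof -
      have "a\<^sup>2 * q \<le> a\<^sup>2 * 1" using q_le_1 by (intro mult_left_mono) auto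
      moreover have "d * d \<le> 1/3 * d" using d3 d by (intro mult_right_mono) auto
      moreover have "a\<^sup>2 = 1 - 2 * d + d * d" by (simp add: d_def power2_eq_square algebra_simps)
      ultimately show ?thesis by argo
    qed
    have "(real k - 1) * D \<le> (real k - 1) * (3/5 * d)" using D kr by (intro mult_left_mono) auto
    \<comment> \<open>The coefficient of \<open>d\<close> is positive from \<open>k = 4\<close> on,
      so \<open>d = 1/3\<close> is the worst case.\<close>
    moreover have "(3/5 * (real k - 1) - 5/3) * d \<le> (3/5 * (real k - 1) - 5/3) * (1/3)"
      using d3 kr by (intro mult_left_mono) auto
    moreover have "(3/5 * (real k - 1) - 5/3) * d = (real k - 1) * (3/5 * d) - 5/3 * d"
      by (simp add: algebra_simps)
    ultimately have Dq: "(real k - 1) * D + a\<^sup>2 * q \<le> real k / 5 + 11/45" using aq by argo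
    have "real k * column_sum2 \<le> real k * D + 2 * a / (1 + a) + a\<^sup>2 * q + ((real k - 1) * y\<^sup>2 - 2 * y) - 1"
      using column_sum2_mult_le by (simp add: y_def)
    moreover have "real k * D = (real k - 1) * D + D" by (simp add: algebra_simps)
    ultimately have main: "real k * column_sum2 \<le> real k / 5 + 11/45 + ((real k - 1) * y\<^sup>2 - 2 * y)"
      using Dq one_minus_D by argo
    have "(real k - 1) * y * y \<le> (real k - 1) * y * (1/3)" using y kr by (intro mult_left_mono) auto
    then have y2: "(real k - 1) * y\<^sup>2 - 2 * y \<le> (real k - 7) * y / 3"
      by (simp add: power2_eq_square algebra_simps)
    \<comment> \<open>The sign of \<open>k - 7\<close> decides whether \<open>y = 0\<close> or
      \<open>y = 1/3\<close> is the worst case.\<close>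
    have "real k / 5 + 11/45 + ((real k - 1) * y\<^sup>2 - 2 * y) \<le> real k / 3 - 1/6"
    proof (cases "real k \<le> 7")
      case True
      then have "(real k - 7) * y \<le> 0" using y by (intro mult_nonpos_nonneg) auto
      then show ?thesis using y2 kr by argo
    next
      case False
      then have "(real k - 7) * y \<le> (real k - 7) * (1/3)" using y by (intro mult_left_mono) auto
      then show ?thesis using y2 kr by argo
    qed
    then have "real k * column_sum2 \<le> real k * rate" using main k_rate by linarith
    then show ?thesis using kr by simp
  qed
qed

lemma column_sum1_le_rate: "column_sum1 \<le> rate"
  using column_sum1_le_small column_sum1_le_large by linarith

lemma column_sum2_le_rate: "column_sum2 \<le> rate"
  using column_sum2_le_small column_sum2_le_large by linarith

text \<open>
  With \<open>a = \<sigma>\<close>, one epoch maps \<open>(U, S\<^sup>2)\<close> in expectation to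
  \<open>(M11 U + M12 S\<^sup>2, M21 U + M22 S\<^sup>2)\<close>.
\<close>

definition M11 where
  "M11 = (real k * D * (1 - a\<^sup>2 * q) - (1 - 2 * a * p + a\<^sup>2 * q) - a\<^sup>2 * V) / (real k - 1)"
definition M12 where "M12 = h\<^sup>2 * V / real k"
definition M21 where "M21 = real k * (a\<^sup>2 * V) / (real k - 1)"
definition M22 where "M22 = (a * p - g)\<^sup>2"

lemma M12_pos: "0 < M12"
proof -
  have "0 < h" unfolding h_def using a_pos a_lt_1 by (simp add: add_pos_nonneg)
  then show ?thesis unfolding M12_def using V_pos k_real by simp
qed

lemma M21_pos: "0 < M21" unfolding M21_def using V_pos k_real a_pos by simp

lemma M_column1_le: "M11 + M21 \<le> rate"
proof -
  have "a\<^sup>2 * q * (real k * D) = a\<^sup>2 * (1 - g\<^sup>2) / (1 + a)\<^sup>2"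
  proof -
    have "real k * D * q = (1 - g\<^sup>2) / (1 + a)\<^sup>2"
    proof -
      have "(1 - g\<^sup>2) / (1 + a)\<^sup>2 = real k * ((1 - a) * (1 + a)) * q / ((1 + a) * (1 + a))"
        unfolding q_eq[symmetric] by (simp add: power2_eq_square algebra_simps)
      then show ?thesis using a_pos by (simp add: D_def)
    qed
    moreover have "a\<^sup>2 * q * (real k * D) = a\<^sup>2 * (real k * D * q)" by (simp only: mult_ac)
    ultimately show ?thesis by (simp only: times_divide_eq_right)
  qed
  moreover have "1 - 2 * a * p + a\<^sup>2 * q = (1 - a * p)\<^sup>2 + a\<^sup>2 * V"
    by (simp add: V_def power2_eq_square algebra_simps)
  ultimately have "M11 + M21 = column_sum1"
    unfolding M11_def M21_def column_sum1_def by (simp add: algebra_simps flip: add_divide_distrib)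
  then show ?thesis using column_sum1_le_rate by simp
qed

lemma M_column2_le: "M12 + M22 \<le> rate"
  using column_sum2_le_rate by (simp add: M12_def M22_def column_sum2_def)

text \<open>Sum and, in \<open>C2\<close>, sum of squares of the weights carried by the old
  coordinates after \<open>j\<close> block updates; the average over orders depends on the weights
  only through these.\<close>

definition C1 where "C1 j = (\<Sum>i<j. a ^ (j - i))"
definition C2 where "C2 j = (\<Sum>i<j. (a ^ (j - i))\<^sup>2)"

lemma C1_eq: "C1 j = a * (\<Sum>i<j. a ^ i)"
proof -
  have "C1 j = (\<Sum>i<j. a ^ Suc i)"
    unfolding C1_def using sum.nat_diff_reindex[of "\<lambda>i. a ^ Suc i" j]
    by (simp add: Suc_diff_Suc)
  then show ?thesis by (simp add: sum_distrib_left)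
qed

lemma C2_eq: "C2 j = a\<^sup>2 * (\<Sum>i<j. a ^ (2 * i))"
proof -
  have "C2 j = (\<Sum>i<j. (a ^ Suc i)\<^sup>2)"
    unfolding C2_def using sum.nat_diff_reindex[of "\<lambda>i. (a ^ Suc i)\<^sup>2" j]
    by (simp add: Suc_diff_Suc)
  then show ?thesis by (simp add: sum_distrib_left power_mult_distrib power_even_eq)
qed

text \<open>The factor \<open>(1 - a) / a\<close> relating a new coordinate to the running sum
  cancels the denominator of the geometric sum.\<close>

lemma C1_closed: "(1 - a) / a * C1 j = 1 - a ^ j"
  using one_diff_power_eq[of a j] a_pos by (simp add: C1_eq)

lemma C2_closed: "((1 - a) / a)\<^sup>2 * C2 j = D * (1 - a ^ (2 * j))"
proof -
  have "(1 - a ^ (2 * j)) = (1 - a\<^sup>2) * (\<Sum>i<j. a ^ (2 * i))"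
    using one_diff_power_eq[of "a\<^sup>2" j] by (simp flip: power_mult)
  moreover have "D * (1 - a\<^sup>2) = (1 - a)\<^sup>2" 
  proof -
    have "1 - a\<^sup>2 = (1 + a) * (1 - a)" by (simp add: power2_eq_square algebra_simps)
    then show ?thesis using a_pos by (simp add: D_def power2_eq_square)
  qed
  ultimately show ?thesis using a_pos by (simp add: C2_eq power_divide mult.assoc[symmetric])
qed

lemma C1_k: "C1 k = a * (real k * p)"
  using k_real by (simp add: C1_eq p_def)

lemma C2_k: "C2 k = a\<^sup>2 * (real k * q)"
  using k_real by (simp add: C2_eq q_def)

lemma sum_coefficient_k: "(a ^ k - C1 k / real k)\<^sup>2 = M22"
  using k_real by (simp add: C1_k M22_def power2_commute flip: g_def)

lemma square_coefficient_k: "(C2 k - (C1 k)\<^sup>2 / real k) / (real k - 1) = M21"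
  using k_real unfolding C1_k C2_k M21_def V_def by (simp add: power2_eq_square algebra_simps)

text \<open>The coefficient of \<open>S\<^sup>2\<close> in the mean of the squared block norm
  \<open>U + S\<^sup>2 / k\<close>, hence row one plus \<open>1 / k\<close> times row two. Each
  scaled summand is \<open>((h * a ^ j - 1) / k)\<^sup>2\<close>, and averaging splits it into
  variance and squared bias \<open>(h * p - 1)\<^sup>2\<close>.\<close>

lemma sum_coefficient:
  "((1 - a) / a)\<^sup>2 * (\<Sum>j<k. (a ^ Suc j - C1 (Suc j) / real k)\<^sup>2) = M12 + M22 / real k"
proof -
  have "(1 - a) / a * (a ^ Suc j - C1 (Suc j) / real k) = (h * a ^ j - 1) / real k" for j
  proof -
    have "(1 - a) / a * (a ^ Suc j - C1 (Suc j) / real k)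
        = (1 - a) / a * a ^ Suc j - ((1 - a) / a * C1 (Suc j)) / real k"
      by (simp add: right_diff_distrib)
    also have "\<dots> = (1 - a) * a ^ j - (1 - a ^ Suc j) / real k"
      unfolding C1_closed using a_pos by simp
    also have "\<dots> = (h * a ^ j - 1) / real k"
      using k_real by (simp add: h_def field_simps)
    finally show ?thesis .
  qed
  then have "((1 - a) / a)\<^sup>2 * (\<Sum>j<k. (a ^ Suc j - C1 (Suc j) / real k)\<^sup>2)
      = (\<Sum>j<k. ((h * a ^ j - 1) / real k)\<^sup>2)"
    by (simp only: sum_distrib_left power_mult_distrib[symmetric])
  also have "\<dots> = (\<Sum>j<k. h\<^sup>2 * a ^ (2 * j) - 2 * h * a ^ j + 1) / (real k)\<^sup>2"
    unfolding sum_divide_distrib power_divide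
    by (intro sum.cong refl arg_cong2[of _ _ _ _ "(/)"])
      (simp only: power_even_eq power2_diff power_mult_distrib, simp)
  also have "(\<Sum>j<k. h\<^sup>2 * a ^ (2 * j) - 2 * h * a ^ j + 1) = real k * (h\<^sup>2 * q - 2 * h * p + 1)"
  proof -
    have "(\<Sum>j<k. h\<^sup>2 * a ^ (2 * j) - 2 * h * a ^ j + 1)
        = h\<^sup>2 * (\<Sum>j<k. a ^ (2 * j)) - 2 * h * (\<Sum>j<k. a ^ j) + real k"
      by (simp only: sum.distrib sum_subtractf sum_distrib_left) simp
    also have "(\<Sum>j<k. a ^ (2 * j)) = real k * q" using k_real by (simp add: q_def)
    also have "(\<Sum>j<k. a ^ j) = real k * p" using k_real by (simp add: p_def)
    finally show ?thesis by (simp add: algebra_simps)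
  qed
  also have "real k * (h\<^sup>2 * q - 2 * h * p + 1) / (real k)\<^sup>2 = (h\<^sup>2 * q - 2 * h * p + 1) / real k"
    using k_real by (simp add: power2_eq_square)
  also have "h\<^sup>2 * q - 2 * h * p + 1 = h\<^sup>2 * V + (h * p - 1)\<^sup>2"
    by (simp add: V_def power2_eq_square algebra_simps)
  also have "h * p - 1 = a * p - g" using p_eq by (simp add: h_def algebra_simps)
  finally show ?thesis by (simp add: M12_def M22_def add_divide_distrib)
qed

lemma square_coefficient:
  "((1 - a) / a)\<^sup>2 * (\<Sum>j<k. (C2 (Suc j) - (C1 (Suc j))\<^sup>2 / real k) / (real k - 1)) = M11 + M21 / real k"
proof -
  have "((1 - a) / a)\<^sup>2 * ((C2 (Suc j) - (C1 (Suc j))\<^sup>2 / real k) / (real k - 1))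
      = (D * (1 - a\<^sup>2 * a ^ (2 * j)) - (1 - 2 * a * a ^ j + a\<^sup>2 * a ^ (2 * j)) / real k) / (real k - 1)" for j
  proof -
    have "((1 - a) / a)\<^sup>2 * ((C2 (Suc j) - (C1 (Suc j))\<^sup>2 / real k) / (real k - 1))
        = (((1 - a) / a)\<^sup>2 * C2 (Suc j) - ((1 - a) / a * C1 (Suc j))\<^sup>2 / real k) / (real k - 1)"
      by (simp add: power_mult_distrib power_divide right_diff_distrib)
    also have "\<dots> = (D * (1 - a ^ (2 * Suc j)) - (1 - a ^ Suc j)\<^sup>2 / real k) / (real k - 1)"
      unfolding C1_closed C2_closed ..
    also have "a ^ (2 * Suc j) = a\<^sup>2 * a ^ (2 * j)" by (simp add: power2_eq_square)
    also have "(1 - a ^ Suc j)\<^sup>2 = 1 - 2 * a * a ^ j + a\<^sup>2 * a ^ (2 * j)"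
      by (simp add: power2_diff power_mult_distrib power_even_eq)
    finally show ?thesis .
  qed
  then have "((1 - a) / a)\<^sup>2 * (\<Sum>j<k. (C2 (Suc j) - (C1 (Suc j))\<^sup>2 / real k) / (real k - 1))
      = (\<Sum>j<k. (D * (1 - a\<^sup>2 * a ^ (2 * j)) - (1 - 2 * a * a ^ j + a\<^sup>2 * a ^ (2 * j)) / real k) / (real k - 1))"
    by (simp only: sum_distrib_left)
  also have "\<dots> = (D * (\<Sum>j<k. 1 - a\<^sup>2 * a ^ (2 * j)) - (\<Sum>j<k. 1 - 2 * a * a ^ j + a\<^sup>2 * a ^ (2 * j)) / real k) / (real k - 1)"
    by (simp only: sum_divide_distrib[symmetric] sum_subtractf sum_distrib_left[symmetric])
  also have "(\<Sum>j<k. 1 - a\<^sup>2 * a ^ (2 * j)) = real k * (1 - a\<^sup>2 * q)"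
    using k_real by (simp add: sum_subtractf q_def algebra_simps flip: sum_distrib_left)
  also have "(\<Sum>j<k. 1 - 2 * a * a ^ j + a\<^sup>2 * a ^ (2 * j)) = real k * (1 - 2 * a * p + a\<^sup>2 * q)"
    using k_real by (simp add: sum_subtractf sum.distrib p_def q_def algebra_simps flip: sum_distrib_left)
  finally show ?thesis using k_real
    by (simp add: M11_def M21_def mult_ac flip: add_divide_distrib)
qed

end

section \<open>Averages over permutations\<close>

text \<open>Composing with a transposition shows that the sum does not depend on the position
  \<open>a\<close>; summing over all positions then gives the total of \<open>f\<close> for each
  permutation.\<close>

lemma sum_permutes_apply:
  fixes f :: "'a \<Rightarrow> real"
  assumes A: "finite A" and a: "a \<in> A"
  shows "real (card A) * (\<Sum>\<pi> | \<pi> permutes A. f (\<pi> a)) = real (card {\<pi>. \<pi> permutes A}) * sum f A"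
proof -
  have eq: "(\<Sum>\<pi> | \<pi> permutes A. f (\<pi> b)) = (\<Sum>\<pi> | \<pi> permutes A. f (\<pi> a))" if "b \<in> A" for b
    using sum_permutations_compose_right[OF permutes_swap_id[OF a that], of "\<lambda>\<pi>. f (\<pi> b)"]
    by simp
  have "real (card A) * (\<Sum>\<pi> | \<pi> permutes A. f (\<pi> a)) = (\<Sum>b\<in>A. \<Sum>\<pi> | \<pi> permutes A. f (\<pi> b))"
    by (simp add: eq)
  also have "\<dots> = (\<Sum>\<pi> | \<pi> permutes A. \<Sum>b\<in>A. f (\<pi> b))" by (rule sum.swap)
  also have "\<dots> = (\<Sum>\<pi> | \<pi> permutes A. sum f A)"
    by (rule sum.cong[OF refl]) (use sum.permute[of _ A f] in \<open>simp add: o_def\<close>)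
  finally show ?thesis by simp
qed

text \<open>Covariances of sampling without replacement. Transpositions fixing \<open>a\<close> make
  all off-diagonal values equal; since \<open>z\<close> sums to zero, they add up to minus the
  diagonal one, which \<open>sum_permutes_apply\<close> gives.\<close>

lemma sum_permutes_apply_pair:
  fixes z :: "'a \<Rightarrow> real"
  assumes A: "finite A" and z: "sum z A = 0" and k: "2 \<le> card A" and ab: "a \<in> A" "b \<in> A"
  shows "(\<Sum>\<pi> | \<pi> permutes A. z (\<pi> a) * z (\<pi> b)) =
    real (card {\<pi>. \<pi> permutes A}) * (\<Sum>i\<in>A. (z i)\<^sup>2) / (real (card A) - 1)
      * ((if a = b then 1 else 0) - 1 / real (card A))"
proof -
  let ?P = "{\<pi>. \<pi> permutes A}" and ?k = "real (card A)"
  define X where "X = (\<lambda>a b. \<Sum>\<pi>\<in>?P. z (\<pi> a) * z (\<pi> b))"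
  have k': "2 \<le> ?k" using k by simp
  have diag: "?k * X a a = real (card ?P) * (\<Sum>i\<in>A. (z i)\<^sup>2)"
    using sum_permutes_apply[OF A ab(1), of "\<lambda>i. (z i)\<^sup>2"] by (simp add: X_def power2_eq_square)
  show ?thesis
  proof (cases "a = b")
    case True
    then show ?thesis using diag k' unfolding X_def by (simp add: field_simps)
  next
    case False
    have eq: "X a c = X a b" if c: "c \<in> A - {a}" for c
    proof -
      have "X a c = (\<Sum>\<pi>\<in>?P. z ((\<pi> \<circ> Transposition.transpose c b) a) * z ((\<pi> \<circ> Transposition.transpose c b) c))"
        unfolding X_def
        using sum_permutations_compose_right[OF permutes_swap_id[of c A b], of "\<lambda>\<pi>. z (\<pi> a) * z (\<pi> c)"] c ab
        by blast
      moreover have "Transposition.transpose c b a = a"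
        using c False by (auto simp: Transposition.transpose_def)
      ultimately show ?thesis by (simp add: X_def)
    qed
    have "X a a + (?k - 1) * X a b = X a a + (\<Sum>c\<in>A - {a}. X a c)"
      using eq A ab k by (simp add: of_nat_diff)
    also have "\<dots> = (\<Sum>c\<in>A. X a c)" using A ab by (simp add: sum.remove)
    also have "\<dots> = (\<Sum>\<pi>\<in>?P. \<Sum>c\<in>A. z (\<pi> a) * z (\<pi> c))" unfolding X_def by (rule sum.swap)
    also have "\<dots> = (\<Sum>\<pi>\<in>?P. z (\<pi> a) * sum z A)"
      using sum.permute[of _ A z] by (intro sum.cong refl) (simp add: o_def flip: sum_distrib_left)
    also have "\<dots> = 0" by (simp add: z)
    finally have "(?k - 1) * X a b = - X a a" by linarith
    then have "(?k * (?k - 1)) * X a b = - (?k * X a a)"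
      by (metis minus_mult_right mult.assoc)
    then have "X a b = - (?k * X a a) / (?k * (?k - 1))"
    proof -
      have "?k * (?k - 1) \<noteq> 0" using k' by simp
      then show ?thesis using \<open>(?k * (?k - 1)) * X a b = - (?k * X a a)\<close>
        by (metis nonzero_mult_div_cancel_left)
    qed
    then have "X a b = - (real (card ?P) * (\<Sum>i\<in>A. (z i)\<^sup>2)) / (?k * (?k - 1))"
      by (simp only: diag)
    then show ?thesis using False by (simp add: X_def mult.commute)
  qed
qed

text \<open>After centring \<open>f\<close> the form is a constant minus a linear form of mean zero,
  so the cross term vanishes and the pair averages give the rest. The index set is general because
  the first \<open>j\<close> updates see only \<open>j\<close> positions.\<close>

lemma sum_permutes_linear_form:
  fixes f :: "'a \<Rightarrow> real" and c :: "'i \<Rightarrow> real"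
  assumes A: "finite A" and k: "2 \<le> card A"
    and I: "finite I" and x: "inj_on x I" "x ` I \<subseteq> A"
  shows "(\<Sum>\<pi> | \<pi> permutes A. (\<alpha> * sum f A - (\<Sum>i\<in>I. c i * f (\<pi> (x i))))\<^sup>2) =
    real (card {\<pi>. \<pi> permutes A}) *
      ((sum f A)\<^sup>2 * (\<alpha> - sum c I / real (card A))\<^sup>2
       + ((\<Sum>i\<in>A. (f i)\<^sup>2) - (sum f A)\<^sup>2 / real (card A))
         * (((\<Sum>i\<in>I. (c i)\<^sup>2) - (sum c I)\<^sup>2 / real (card A)) / (real (card A) - 1)))"
proof -
  let ?P = "{\<pi>. \<pi> permutes A}"
  define K where "K = real (card A)"
  define m where "m = sum f A / K"
  define z where "z = (\<lambda>i. f i - m)"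
  define U where "U = (\<Sum>i\<in>A. (z i)\<^sup>2)"
  define \<beta> where "\<beta> = sum f A * (\<alpha> - sum c I / K)"
  define L where "L = (\<lambda>\<pi>. \<Sum>i\<in>I. c i * z (\<pi> (x i)))"
  define B where "B = real (card ?P) * U / (K - 1)"
  have K: "2 \<le> K" using k by (simp add: K_def)
  have z0: "sum z A = 0" using K by (simp add: z_def sum_subtractf m_def K_def)
  have U: "U = (\<Sum>i\<in>A. (f i)\<^sup>2) - (sum f A)\<^sup>2 / K"
  proof -
    have "(z i)\<^sup>2 = (f i)\<^sup>2 - 2 * m * f i + m\<^sup>2" for i by (simp add: z_def power2_diff)
    then have "U = (\<Sum>i\<in>A. (f i)\<^sup>2) - 2 * m * sum f A + K * m\<^sup>2"
      by (simp add: U_def sum.distrib sum_subtractf K_def sum_distrib_left)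
    then show ?thesis using K by (simp add: m_def power2_eq_square)
  qed
  have split: "\<alpha> * sum f A - (\<Sum>i\<in>I. c i * f (\<pi> (x i))) = \<beta> - L \<pi>" for \<pi>
  proof -
    have "(\<Sum>i\<in>I. c i * f (\<pi> (x i))) = L \<pi> + sum c I * m"
      by (simp add: L_def z_def right_diff_distrib sum_subtractf sum_distrib_right)
    then show ?thesis by (simp add: \<beta>_def m_def algebra_simps)
  qed
  have "(\<Sum>\<pi>\<in>?P. z (\<pi> (x i))) = 0" if "i \<in> I" for i
  proof -
    have "x i \<in> A" using x that by auto
    from sum_permutes_apply[OF A this, of z] show ?thesis using z0 K by (simp add: K_def)
  qed
  moreover have "(\<Sum>\<pi>\<in>?P. L \<pi>) = (\<Sum>i\<in>I. c i * (\<Sum>\<pi>\<in>?P. z (\<pi> (x i))))"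
    unfolding L_def by (subst sum.swap) (simp add: sum_distrib_left)
  ultimately have L1: "(\<Sum>\<pi>\<in>?P. L \<pi>) = 0" by simp
  have "(\<Sum>\<pi>\<in>?P. (L \<pi>)\<^sup>2) = (\<Sum>\<pi>\<in>?P. \<Sum>i\<in>I. \<Sum>j\<in>I. c i * c j * (z (\<pi> (x i)) * z (\<pi> (x j))))"
    by (simp add: L_def power2_eq_square sum_product mult_ac)
  also have "\<dots> = (\<Sum>i\<in>I. \<Sum>\<pi>\<in>?P. \<Sum>j\<in>I. c i * c j * (z (\<pi> (x i)) * z (\<pi> (x j))))"
    by (rule sum.swap)
  also have "\<dots> = (\<Sum>i\<in>I. \<Sum>j\<in>I. c i * c j * (\<Sum>\<pi>\<in>?P. z (\<pi> (x i)) * z (\<pi> (x j))))"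
    by (intro sum.cong refl, subst sum.swap) (simp add: sum_distrib_left)
  also have "\<dots> = (\<Sum>i\<in>I. \<Sum>j\<in>I. c i * c j * (B * ((if i = j then 1 else 0) - 1 / K)))"
  proof (intro sum.cong refl)
    fix i j assume ij: "i \<in> I" "j \<in> I"
    then have "x i = x j \<longleftrightarrow> i = j" using x by (auto dest: inj_onD)
    then show "c i * c j * (\<Sum>\<pi>\<in>?P. z (\<pi> (x i)) * z (\<pi> (x j))) = c i * c j * (B * ((if i = j then 1 else 0) - 1 / K))"
      using sum_permutes_apply_pair[OF A z0 k subsetD[OF x(2) imageI[OF ij(1)]] subsetD[OF x(2) imageI[OF ij(2)]]]
      by (simp add: B_def U_def K_def)
  qed
  also have "\<dots> = B * (\<Sum>i\<in>I. \<Sum>j\<in>I. (if i = j then c i * c j else 0) - c i * c j / K)"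
    by (auto simp: sum_distrib_left algebra_simps intro!: sum.cong)
  also have "(\<Sum>i\<in>I. \<Sum>j\<in>I. (if i = j then c i * c j else 0) - c i * c j / K)
      = (\<Sum>i\<in>I. (c i)\<^sup>2) - (sum c I)\<^sup>2 / K"
    using I by (simp add: sum_subtractf power2_eq_square sum_product flip: sum_divide_distrib)
  finally have L2: "(\<Sum>\<pi>\<in>?P. (L \<pi>)\<^sup>2) = B * ((\<Sum>i\<in>I. (c i)\<^sup>2) - (sum c I)\<^sup>2 / K)" .
  have "(\<Sum>\<pi>\<in>?P. (\<alpha> * sum f A - (\<Sum>i\<in>I. c i * f (\<pi> (x i))))\<^sup>2) = (\<Sum>\<pi>\<in>?P. (\<beta> - L \<pi>)\<^sup>2)"
    by (simp only: split)
  also have "\<dots> = real (card ?P) * \<beta>\<^sup>2 - 2 * \<beta> * (\<Sum>\<pi>\<in>?P. L \<pi>) + (\<Sum>\<pi>\<in>?P. (L \<pi>)\<^sup>2)"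
    by (simp add: power2_diff sum.distrib sum_subtractf sum_distrib_left)
  also have "\<dots> = real (card ?P) * (\<beta>\<^sup>2 + U * (((\<Sum>i\<in>I. (c i)\<^sup>2) - (sum c I)\<^sup>2 / K) / (K - 1)))"
    unfolding L1 L2 B_def by (simp add: distrib_left)
  finally show ?thesis unfolding U \<beta>_def K_def by (simp add: power_mult_distrib)
qed

section \<open>One epoch\<close>

lemma A_class_entries:
  assumes "A \<in> A_class n \<sigma>"
  obtains k w where "2 \<le> k" "k \<le> n" "\<And>i. i < n \<Longrightarrow> w i * w i = (1 :: real)"
    "\<And>i j. i < n \<Longrightarrow> j < n \<Longrightarrow>
      A $$ (i, j) = w i * w j * (if i = j then 1 else if i < k \<and> j < k then 1 - \<sigma> else 0)"
proof -
  obtain k v where kv: "2 \<le> k" "k \<le> n" "v \<in> carrier_vec n" "\<forall>i<n. v $ i \<in> {1, -1}"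
    and A: "A = hadamard (diag_block_mat [\<sigma> \<cdot>\<^sub>m 1\<^sub>m k + (1 - \<sigma>) \<cdot>\<^sub>m outer_prod (ones_vec k) (ones_vec k), 1\<^sub>m (n - k)])
        (outer_prod v v)"
    using assms unfolding A_class_def PI_class_def by blast
  show ?thesis
  proof (rule that[OF kv(1,2), of "\<lambda>i. v $ i"])
    show "v $ i * v $ i = 1" if "i < n" for i using kv(4) that by fastforce
    show "A $$ (i, j) = v $ i * v $ j * (if i = j then 1 else if i < k \<and> j < k then 1 - \<sigma> else 0)"
      if "i < n" "j < n" for i j
      using that kv(2,3) by (auto simp: A hadamard_def outer_prod_def ones_vec_def)
  qed
qed

lemma permutations_nonempty: "{p. p permutes A} \<noteq> {}"
  using permutes_id by blast

locale rpcd_block =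
  fixes n k :: nat and \<sigma> :: real and A :: "real mat" and w :: "nat \<Rightarrow> real"
  assumes k_ge_2: "2 \<le> k" and k_le_n: "k \<le> n"
    and \<sigma>_pos: "0 < \<sigma>" and \<sigma>_le_1: "\<sigma> \<le> 1"
    and A_in_class: "A \<in> A_class n \<sigma>"
    and w_square: "\<And>i. i < n \<Longrightarrow> w i * w i = 1"
    and A_entry: "\<And>i j. i < n \<Longrightarrow> j < n \<Longrightarrow>
      A $$ (i, j) = w i * w j * (if i = j then 1 else if i < k \<and> j < k then 1 - \<sigma> else 0)"
begin

abbreviation f where "f \<equiv> quadratic A"

text \<open>The sign flip is not carried out on \<open>A\<close> or \<open>x\<close>; the products
  \<open>w i * x $ i\<close> play the part of the flipped coordinates.\<close>

definition S where "S x = (\<Sum>i<k. w i * x $ i)"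

definition Q where "Q x = (\<Sum>i<k. (x $ i)\<^sup>2)"

text \<open>The signed sum after the first \<open>j\<close> coupled coordinates in the order \<open>ys\<close> have been updated.\<close>

definition partial_sum where
  "partial_sum x ys j = \<sigma> ^ j * S x - (\<Sum>i<j. \<sigma> ^ (j - i) * (w (ys ! i) * x $ (ys ! i)))"

lemma row_A_prod:
  assumes x: "x \<in> carrier_vec n" and i: "i < n"
  shows "row A i \<bullet> x = (if i < k then \<sigma> * x $ i + (1 - \<sigma>) * w i * S x else x $ i)"
proof -
  have A: "A \<in> carrier_mat n n" using A_class_carrier[OF A_in_class] .
  have "row A i \<bullet> x = (\<Sum>j<n. A $$ (i, j) * x $ j)"
    using A x i by (simp add: scalar_prod_def atLeast0LessThan)
  also have "\<dots> = (\<Sum>j<n. (if j = i then x $ i else 0)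
      + w i * (if i < k \<and> j \<noteq> i \<and> j < k then (1 - \<sigma>) * (w j * x $ j) else 0))"
    using i w_square by (intro sum.cong) (auto simp: A_entry mult_ac)
  also have "\<dots> = x $ i + w i * (\<Sum>j<n. if i < k \<and> j \<noteq> i \<and> j < k then (1 - \<sigma>) * (w j * x $ j) else 0)"
    using i by (simp add: sum.distrib sum_distrib_left)
  finally have eq: "row A i \<bullet> x =
      x $ i + w i * (\<Sum>j<n. if i < k \<and> j \<noteq> i \<and> j < k then (1 - \<sigma>) * (w j * x $ j) else 0)" .
  show ?thesis
  proof (cases "i < k")
    case True
    have "(\<Sum>j<n. if i < k \<and> j \<noteq> i \<and> j < k then (1 - \<sigma>) * (w j * x $ j) else 0)
        = (\<Sum>j\<in>{..<k} - {i}. (1 - \<sigma>) * (w j * x $ j))"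
      using True k_le_n by (intro sum.mono_neutral_cong_right) auto
    also have "\<dots> = (1 - \<sigma>) * (S x - w i * x $ i)"
      using True by (simp add: S_def sum_diff1 flip: sum_distrib_left)
    finally have "row A i \<bullet> x = x $ i + w i * ((1 - \<sigma>) * (S x - w i * x $ i))" using eq by simp
    also have "\<dots> = x $ i + (1 - \<sigma>) * w i * S x - (1 - \<sigma>) * (w i * w i) * x $ i"
      by (simp add: algebra_simps)
    finally show ?thesis using True w_square[OF i] by (simp add: algebra_simps)
  qed (use eq in simp)
qed

text \<open>In signed coordinates the new entry is \<open>- (1 - \<sigma>)\<close> times the sum of
  the others, and the total becomes \<open>\<sigma>\<close> times that sum.\<close>

lemma coord_step_eq:
  assumes x: "x \<in> carrier_vec n" and i: "i < n"
  shows "coord_step f i x = x |\<^sub>v i \<mapsto> (if i < k then - (1 - \<sigma>) * w i * (S x - w i * x $ i) else 0)"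
proof -
  have "coord_step f i x = x |\<^sub>v i \<mapsto> (x $ i - row A i \<bullet> x)"
    unfolding coord_step_def arg_min_def coord_step_quadratic(1)[OF A_in_class x i] by simp
  also have "x $ i - row A i \<bullet> x = (if i < k then - (1 - \<sigma>) * w i * (S x - w i * x $ i) else 0)"
  proof (cases "i < k")
    case True
    have "- (1 - \<sigma>) * w i * (S x - w i * x $ i) = (1 - \<sigma>) * (w i * w i) * x $ i - (1 - \<sigma>) * w i * S x"
      by (simp add: algebra_simps)
    then show ?thesis using True w_square[OF i] row_A_prod[OF x i] by (simp add: algebra_simps)
  qed (simp add: row_A_prod[OF x i])
  finally show ?thesis .
qed

lemma S_update:
  assumes "x \<in> carrier_vec n" "i < n"
  shows "S (x |\<^sub>v i \<mapsto> t) = (if i < k then S x - w i * x $ i + w i * t else S x)"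
proof -
  have "S (x |\<^sub>v i \<mapsto> t) = (\<Sum>j<k. if j = i then w i * t else w j * x $ j)"
    unfolding S_def using assms k_le_n by (intro sum.cong) (auto simp: update_vec_def)
  also have "\<dots> = (\<Sum>j<k. w j * x $ j + (if j = i then w i * t - w i * x $ i else 0))"
    by (intro sum.cong) auto
  finally show ?thesis by (simp add: S_def sum.distrib)
qed

lemma partial_sum_append: "j \<le> length ys \<Longrightarrow> partial_sum x (ys @ zs) j = partial_sum x ys j"
  unfolding partial_sum_def by (simp add: nth_append)

lemma partial_sum_Suc: "partial_sum x ys (Suc j) = \<sigma> * (partial_sum x ys j - w (ys ! j) * x $ (ys ! j))"
  unfolding partial_sum_def
  by (simp add: right_diff_distrib distrib_left sum_distrib_left Suc_diff_le mult_ac)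

text \<open>By distinctness a coordinate still has its initial value when its turn comes, so the sum
  follows \<open>partial_sum_Suc\<close>, and later steps leave the written value alone. The
  coordinate at position \<open>j\<close> is tied to the sum after its own update, hence
  \<open>Suc j\<close>.\<close>

lemma fold_coord_step:
  assumes "x \<in> carrier_vec n" "distinct xs" "set xs \<subseteq> {..<n}"
    and "x' = fold (coord_step f) xs x" and "ys = filter (\<lambda>i. i < k) xs"
  shows "x' \<in> carrier_vec n
    \<and> (\<forall>i<n. i \<notin> set xs \<longrightarrow> x' $ i = x $ i)
    \<and> (\<forall>i\<in>set xs. k \<le> i \<longrightarrow> x' $ i = 0)
    \<and> (\<forall>j<length ys. w (ys ! j) * x' $ (ys ! j) = - ((1 - \<sigma>) / \<sigma>) * partial_sum x ys (Suc j))
    \<and> S x' = partial_sum x ys (length ys)"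
  using assms
proof (induction xs arbitrary: x' ys rule: rev_induct)
  case Nil
  then show ?case by (simp add: partial_sum_def)
next
  case (snoc i xs)
  define y where "y = fold (coord_step f) xs x"
  define zs where "zs = filter (\<lambda>i. i < k) xs"
  have IH: "y \<in> carrier_vec n" "\<And>i. i < n \<Longrightarrow> i \<notin> set xs \<Longrightarrow> y $ i = x $ i"
    "\<And>i. i \<in> set xs \<Longrightarrow> k \<le> i \<Longrightarrow> y $ i = 0"
    "\<And>j. j < length zs \<Longrightarrow> w (zs ! j) * y $ (zs ! j) = - ((1 - \<sigma>) / \<sigma>) * partial_sum x zs (Suc j)"
    "S y = partial_sum x zs (length zs)"
    using snoc.IH[OF _ _ _ y_def zs_def] snoc.prems by auto
  have i: "i < n" "i \<notin> set xs" and xs: "set xs \<subseteq> {..<n}" using snoc.prems by auto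
  define t where "t = (if i < k then - (1 - \<sigma>) * w i * (S y - w i * y $ i) else 0)"
  have x': "x' = y |\<^sub>v i \<mapsto> t"
    using snoc.prems(4) coord_step_eq[OF IH(1) i(1)] by (simp add: y_def t_def)
  have x'_i: "x' $ i = t" and x'_other: "\<And>j. j < n \<Longrightarrow> j \<noteq> i \<Longrightarrow> x' $ j = y $ j"
    using IH(1) i by (auto simp: x' update_vec_def)
  have Sx': "S x' = (if i < k then S y - w i * y $ i + w i * t else S y)"
    unfolding x' using S_update[OF IH(1) i(1)] .
  have zs_set: "zs ! j \<in> set xs" if "j < length zs" for j
    using nth_mem[OF that] by (simp add: zs_def)
  then have x'_zs: "x' $ (zs ! j) = y $ (zs ! j)" if "j < length zs" for j
    using that xs i by (intro x'_other) auto
  have carrier: "x' \<in> carrier_vec n" using IH(1) unfolding x' update_vec_def by (intro carrier_vecI) auto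
  have untouched: "\<forall>j<n. j \<notin> set (xs @ [i]) \<longrightarrow> x' $ j = x $ j" using x'_other IH(2) by simp
  have zeros: "\<forall>j\<in>set (xs @ [i]). k \<le> j \<longrightarrow> x' $ j = 0"
  proof (intro ballI impI)
    fix j assume j: "j \<in> set (xs @ [i])" "k \<le> j"
    show "x' $ j = 0"
    proof (cases "j = i")
      case True
      then show ?thesis using j by (simp add: x'_i t_def)
    next
      case False
      then have "j \<in> set xs" using j by simp
      moreover from this have "j < n" using xs by auto
      ultimately show ?thesis using x'_other[OF _ False] IH(3) j by simp
    qed
  qed
  show ?case
  proof (cases "i < k")
    case True
    have ys: "ys = zs @ [i]" using snoc.prems(5) True by (simp add: zs_def)
    have last: "partial_sum x ys (Suc (length zs)) = \<sigma> * (S y - w i * y $ i)"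
      unfolding partial_sum_Suc ys by (simp add: partial_sum_append IH(2,5) i)
    have wt: "w i * t = - (1 - \<sigma>) * (S y - w i * y $ i)"
    proof -
      have "w i * t = - (1 - \<sigma>) * (w i * w i) * (S y - w i * y $ i)" using True by (simp add: t_def)
      then show ?thesis using w_square[OF i(1)] by simp
    qed
    have "w (ys ! j) * x' $ (ys ! j) = - ((1 - \<sigma>) / \<sigma>) * partial_sum x ys (Suc j)" if "j < length ys" for j
    proof (cases "j < length zs")
      case True
      then show ?thesis using IH(4)[OF True] x'_zs[OF True]
        by (simp add: ys nth_append partial_sum_append)
    next
      case False
      then have "j = length zs" using that by (simp add: ys)
      then have "w (ys ! j) * x' $ (ys ! j) = - (1 - \<sigma>) * (S y - w i * y $ i)"
        using wt by (simp add: ys x'_i)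
      also have "\<dots> = - ((1 - \<sigma>) / \<sigma>) * (\<sigma> * (S y - w i * y $ i))"
      proof -
        have "- (1 - \<sigma>) * z = - ((1 - \<sigma>) / \<sigma>) * (\<sigma> * z)" for z
          using \<sigma>_pos by (simp add: field_simps)
        then show ?thesis .
      qed
      finally show ?thesis using \<open>j = length zs\<close> by (simp only: last)
    qed
    moreover have "S x' = partial_sum x ys (length ys)"
    proof -
      have "S x' = \<sigma> * (S y - w i * y $ i)" using Sx' True wt by (simp add: algebra_simps)
      then show ?thesis using last by (simp add: ys)
    qed
    ultimately show ?thesis using carrier untouched zeros by blast
  next
    case False
    then have ys: "ys = zs" using snoc.prems(5) by (simp add: zs_def)
    have "w (ys ! j) * x' $ (ys ! j) = - ((1 - \<sigma>) / \<sigma>) * partial_sum x ys (Suc j)" if "j < length ys" for j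
      using that unfolding ys by (simp only: x'_zs IH(4))
    moreover have "S x' = partial_sum x ys (length ys)" using Sx' False IH(5) by (simp add: ys)
    ultimately show ?thesis using carrier untouched zeros by blast
  qed
qed

text \<open>The order in which an epoch visits the coupled coordinates.\<close>

definition order_of where "order_of p = filter (\<lambda>i. i < k) (map p [0..<n])"

lemma order_of:
  assumes "p permutes {..<n}"
  shows "distinct (order_of p)" "set (order_of p) = {..<k}" "length (order_of p) = k"
proof -
  have "inj_on p {0..<n}" using assms permutes_inj_on by blast
  then show d: "distinct (order_of p)" by (simp add: order_of_def distinct_map)
  have "p ` {..<n} = {..<n}" using assms by (rule permutes_image)
  then show s: "set (order_of p) = {..<k}"
    using k_le_n by (auto simp: order_of_def atLeast0LessThan)
  show "length (order_of p) = k" using distinct_card[OF d] s by simp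
qed

text \<open>A permutation of the block respects the test \<open>i < k\<close> and so passes through
  the filter; the block order can be reshuffled while its interleaving with the other coordinates
  stays fixed.\<close>

lemma order_of_comp:
  assumes "\<pi> permutes {..<k}"
  shows "order_of (\<pi> \<circ> p) = map \<pi> (order_of p)"
proof -
  have "\<pi> i < k \<longleftrightarrow> i < k" for i using permutes_in_image[OF assms, of i] by simp
  then show ?thesis by (simp add: order_of_def filter_map o_def)
qed

lemma rpcd_epoch_result:
  assumes x: "x \<in> carrier_vec n" and p: "p permutes {..<n}" and x': "x' = rpcd_epoch f n p x"
  shows "x' \<in> carrier_vec n" "\<And>i. k \<le> i \<Longrightarrow> i < n \<Longrightarrow> x' $ i = 0"
    "S x' = partial_sum x (order_of p) k"
    "Q x' = ((1 - \<sigma>) / \<sigma>)\<^sup>2 * (\<Sum>j<k. (partial_sum x (order_of p) (Suc j))\<^sup>2)"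
proof -
  have inj: "inj_on p {0..<n}" using p permutes_inj_on by blast
  have img: "set (map p [0..<n]) = {..<n}" using permutes_image[OF p] by (simp add: atLeast0LessThan)
  note ord = order_of[OF p]
  have dist: "distinct (map p [0..<n])" using inj by (simp add: distinct_map)
  have sub: "set (map p [0..<n]) \<subseteq> {..<n}" using img by simp
  have main: "x' \<in> carrier_vec n" "\<forall>i\<in>set (map p [0..<n]). k \<le> i \<longrightarrow> x' $ i = 0"
    "\<forall>j<length (order_of p). w (order_of p ! j) * x' $ (order_of p ! j)
      = - ((1 - \<sigma>) / \<sigma>) * partial_sum x (order_of p) (Suc j)"
    "S x' = partial_sum x (order_of p) (length (order_of p))"
    using fold_coord_step[OF x dist sub x'[unfolded rpcd_epoch_def] order_of_def] by blast+
  show "x' \<in> carrier_vec n" "\<And>i. k \<le> i \<Longrightarrow> i < n \<Longrightarrow> x' $ i = 0"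
    "S x' = partial_sum x (order_of p) k"
    using main ord(3) unfolding img by auto
  have bij: "bij_betw ((!) (order_of p)) {..<k} (set (order_of p))"
    by (rule bij_betw_nth) (simp_all add: ord)
  have "Q x' = (\<Sum>i\<in>set (order_of p). (w i * x' $ i)\<^sup>2)"
    unfolding Q_def ord(2) using w_square k_le_n
    by (intro sum.cong) (auto simp: power_mult_distrib power2_eq_square)
  also have "\<dots> = (\<Sum>j<k. (w (order_of p ! j) * x' $ (order_of p ! j))\<^sup>2)"
    by (rule sum.reindex_bij_betw[OF bij, symmetric])
  also have "\<dots> = (\<Sum>j<k. ((1 - \<sigma>) / \<sigma>)\<^sup>2 * (partial_sum x (order_of p) (Suc j))\<^sup>2)"
    using main(3) ord(3) by (intro sum.cong) (auto simp: power_mult_distrib power_divide)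
  finally show "Q x' = ((1 - \<sigma>) / \<sigma>)\<^sup>2 * (\<Sum>j<k. (partial_sum x (order_of p) (Suc j))\<^sup>2)"
    by (simp only: sum_distrib_left)
qed

text \<open>The mean of \<open>(partial_sum x ys j)\<^sup>2\<close> over reorderings of the block,
  as \<open>sum_permutes_linear_form\<close> yields it; the difference
  \<open>Q x - (S x)\<^sup>2 / real k\<close> is the later \<open>U x\<close>.\<close>

definition avg_square where
  "avg_square x j = (S x)\<^sup>2 * (\<sigma> ^ j - (\<Sum>i<j. \<sigma> ^ (j - i)) / real k)\<^sup>2
    + (Q x - (S x)\<^sup>2 / real k)
      * (((\<Sum>i<j. (\<sigma> ^ (j - i))\<^sup>2) - (\<Sum>i<j. \<sigma> ^ (j - i))\<^sup>2 / real k) / (real k - 1))"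

lemma sum_partial_sum_permuted:
  assumes ys: "distinct ys" "set ys = {..<k}" and j: "j \<le> k"
  shows "(\<Sum>\<pi> | \<pi> permutes {..<k}. (partial_sum x (map \<pi> ys) j)\<^sup>2)
    = real (card {\<pi>. \<pi> permutes {..<k}}) * avg_square x j"
proof -
  have len: "length ys = k" using distinct_card[OF ys(1)] ys(2) by simp
  have q: "(\<Sum>i<k. (w i * x $ i)\<^sup>2) = Q x"
    unfolding Q_def using w_square k_le_n by (intro sum.cong) (auto simp: power_mult_distrib power2_eq_square)
  have "partial_sum x (map \<pi> ys) j
      = \<sigma> ^ j * (\<Sum>i<k. w i * x $ i) - (\<Sum>i<j. \<sigma> ^ (j - i) * (w (\<pi> (ys ! i)) * x $ \<pi> (ys ! i)))" for \<pi>
    using j len unfolding partial_sum_def S_def by (intro arg_cong2[of _ _ _ _ "(-)"] sum.cong) auto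
  moreover have "inj_on ((!) ys) {..<j}"
    using ys(1) j len by (auto simp: inj_on_def nth_eq_iff_index_eq)
  moreover have "(!) ys ` {..<j} \<subseteq> {..<k}" using nth_mem[of _ ys] ys(2) j len by auto
  ultimately show ?thesis
    using sum_permutes_linear_form[of "{..<k}" "{..<j}" "(!) ys" "\<sigma> ^ j" "\<lambda>i. w i * x $ i" "\<lambda>i. \<sigma> ^ (j - i)"]
      k_ge_2 by (simp add: avg_square_def q S_def)
qed

text \<open>Permuting the block reshuffles \<open>p\<close> by a bijection, so it suffices to average over such reshufflings.\<close>

lemma sum_partial_sum:
  assumes j: "j \<le> k"
  shows "(\<Sum>p | p permutes {..<n}. (partial_sum x (order_of p) j)\<^sup>2)
    = real (card {p. p permutes {..<n}}) * avg_square x j"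
proof -
  let ?P = "{p. p permutes {..<n}}" and ?B = "{\<pi>. \<pi> permutes {..<k}}"
  have fin: "finite ?B" "?B \<noteq> {}" using finite_permutations[of "{..<k}"] permutations_nonempty by auto
  have "real (card ?B) * (\<Sum>p\<in>?P. (partial_sum x (order_of p) j)\<^sup>2)
      = (\<Sum>\<pi>\<in>?B. \<Sum>p\<in>?P. (partial_sum x (order_of p) j)\<^sup>2)" by simp
  also have "\<dots> = (\<Sum>\<pi>\<in>?B. \<Sum>p\<in>?P. (partial_sum x (map \<pi> (order_of p)) j)\<^sup>2)"
  proof (rule sum.cong[OF refl])
    fix \<pi> assume "\<pi> \<in> ?B"
    then have \<pi>: "\<pi> permutes {..<k}" by simp
    then have "\<pi> permutes {..<n}" using k_le_n by (auto intro: permutes_subset)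
    from setum_permutations_compose_left[OF this, of "\<lambda>p. (partial_sum x (order_of p) j)\<^sup>2"]
    show "(\<Sum>p\<in>?P. (partial_sum x (order_of p) j)\<^sup>2) = (\<Sum>p\<in>?P. (partial_sum x (map \<pi> (order_of p)) j)\<^sup>2)"
      by (simp add: order_of_comp[OF \<pi>])
  qed
  also have "\<dots> = (\<Sum>p\<in>?P. \<Sum>\<pi>\<in>?B. (partial_sum x (map \<pi> (order_of p)) j)\<^sup>2)" by (rule sum.swap)
  also have "\<dots> = (\<Sum>p\<in>?P. real (card ?B) * avg_square x j)"
    using sum_partial_sum_permuted[OF order_of(1,2) j] by (intro sum.cong) auto
  finally have "real (card ?B) * (\<Sum>p\<in>?P. (partial_sum x (order_of p) j)\<^sup>2)
      = real (card ?B) * (real (card ?P) * avg_square x j)" by (simp add: mult_ac)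
  moreover have "real (card ?B) \<noteq> 0" using fin by simp
  ultimately show ?thesis by simp
qed

text \<open>The transition operator of the Markov chain of iterates, acting on functions.\<close>

definition epoch_mean :: "(real vec \<Rightarrow> real) \<Rightarrow> real vec \<Rightarrow> real" where
  "epoch_mean F x = measure_pmf.expectation (pmf_of_set {p. p permutes {..<n}}) (\<lambda>p. F (rpcd_epoch f n p x))"

lemma epoch_mean_eq_sum:
  "epoch_mean F x = (\<Sum>p | p permutes {..<n}. F (rpcd_epoch f n p x)) / real (card {p. p permutes {..<n}})"
  unfolding epoch_mean_def
  by (rule integral_pmf_of_set[OF permutations_nonempty finite_permutations[OF finite_lessThan]])

lemma card_permutations_pos: "0 < real (card {p. p permutes {..<n}})"
  by (simp add: card_permutations[OF refl])

lemma epoch_mean_S: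
  assumes "x \<in> carrier_vec n"
  shows "epoch_mean (\<lambda>x. (S x)\<^sup>2) x = avg_square x k"
proof -
  have "(\<Sum>p | p permutes {..<n}. (S (rpcd_epoch f n p x))\<^sup>2)
      = (\<Sum>p | p permutes {..<n}. (partial_sum x (order_of p) k)\<^sup>2)"
    using rpcd_epoch_result(3)[OF assms _ refl] by (intro sum.cong) auto
  then show ?thesis using sum_partial_sum[of k] card_permutations_pos by (simp add: epoch_mean_eq_sum)
qed

lemma epoch_mean_Q:
  assumes "x \<in> carrier_vec n"
  shows "epoch_mean Q x = ((1 - \<sigma>) / \<sigma>)\<^sup>2 * (\<Sum>j<k. avg_square x (Suc j))"
proof -
  let ?P = "{p. p permutes {..<n}}"
  have "(\<Sum>p\<in>?P. Q (rpcd_epoch f n p x))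
      = (\<Sum>p\<in>?P. ((1 - \<sigma>) / \<sigma>)\<^sup>2 * (\<Sum>j<k. (partial_sum x (order_of p) (Suc j))\<^sup>2))"
    using rpcd_epoch_result(4)[OF assms _ refl] by (intro sum.cong) auto
  also have "\<dots> = ((1 - \<sigma>) / \<sigma>)\<^sup>2 * (\<Sum>j<k. \<Sum>p\<in>?P. (partial_sum x (order_of p) (Suc j))\<^sup>2)"
    by (subst sum.swap) (simp add: sum_distrib_left)
  also have "\<dots> = real (card ?P) * (((1 - \<sigma>) / \<sigma>)\<^sup>2 * (\<Sum>j<k. avg_square x (Suc j)))"
  proof -
    have "(\<Sum>j<k. \<Sum>p\<in>?P. (partial_sum x (order_of p) (Suc j))\<^sup>2) = (\<Sum>j<k. real (card ?P) * avg_square x (Suc j))"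
      by (intro sum.cong sum_partial_sum) auto
    also have "\<dots> = real (card ?P) * (\<Sum>j<k. avg_square x (Suc j))"
      by (rule sum_distrib_left[symmetric])
    finally show ?thesis by (simp only: mult.left_commute)
  qed
  finally show ?thesis using card_permutations_pos by (simp add: epoch_mean_eq_sum)
qed

section \<open>The limit\<close>

definition U where "U x = Q x - (S x)\<^sup>2 / real k"

lemma k_real: "2 \<le> real k" using k_ge_2 by simp

lemma U_nonneg: "0 \<le> U x"
proof -
  have "(S x)\<^sup>2 \<le> (\<Sum>i<k. (w i)\<^sup>2) * (\<Sum>i<k. (x $ i)\<^sup>2)"
    unfolding S_def by (rule Cauchy_Schwarz_ineq_sum)
  also have "(\<Sum>i<k. (w i)\<^sup>2) = (\<Sum>i<k. 1)"
    using w_square k_le_n by (intro sum.cong) (auto simp: power2_eq_square)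
  finally show ?thesis using k_real by (simp add: U_def Q_def divide_le_eq mult.commute)
qed

lemma epoch_mean_add: "epoch_mean (\<lambda>x. F x + G x) x = epoch_mean F x + epoch_mean G x"
  by (simp add: epoch_mean_eq_sum sum.distrib add_divide_distrib)

lemma epoch_mean_mult: "epoch_mean (\<lambda>x. c * F x) x = c * epoch_mean F x"
  by (simp add: epoch_mean_eq_sum flip: sum_distrib_left)

text \<open>\<open>\<sigma> < 1\<close> makes \<open>M12\<close> and \<open>M21\<close> positive, as
  \<open>perron_2x2\<close> requires.\<close>

lemma epoch_mean_eigenform:
  assumes "\<sigma> < 1"
  obtains l c where "0 < l" "l \<le> max ((1 - 1 / real k) ^ k) ((1 - \<sigma> / real k) ^ (2 * k))" "0 < c"
    "\<And>x. x \<in> carrier_vec n \<Longrightarrow> epoch_mean (\<lambda>x. U x + c * (S x)\<^sup>2) x = l * (U x + c * (S x)\<^sup>2)"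
proof -
  interpret G: geometric_mean \<sigma> k
    using \<sigma>_pos assms k_ge_2 by unfold_locales
  obtain l c where lc: "0 < l" "l \<le> G.rate" "0 < c" "G.M11 + c * G.M21 = l" "G.M12 + c * G.M22 = l * c"
    using perron_2x2[OF G.M12_pos G.M21_pos _ G.M_column1_le G.M_column2_le] by (auto simp: G.M22_def)
  have avg: "avg_square x j = (S x)\<^sup>2 * (\<sigma> ^ j - G.C1 j / real k)\<^sup>2
      + U x * ((G.C2 j - (G.C1 j)\<^sup>2 / real k) / (real k - 1))" for x j
    by (simp add: avg_square_def U_def G.C1_def G.C2_def)
  have mean_S: "epoch_mean (\<lambda>x. (S x)\<^sup>2) x = (S x)\<^sup>2 * G.M22 + U x * G.M21" if "x \<in> carrier_vec n" for x
    unfolding epoch_mean_S[OF that] avg G.sum_coefficient_k G.square_coefficient_k ..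
  have mean_Q: "epoch_mean Q x = (S x)\<^sup>2 * (G.M12 + G.M22 / real k) + U x * (G.M11 + G.M21 / real k)"
    if "x \<in> carrier_vec n" for x
  proof -
    have "epoch_mean Q x = ((1 - \<sigma>) / \<sigma>)\<^sup>2 *
        ((S x)\<^sup>2 * (\<Sum>j<k. (\<sigma> ^ Suc j - G.C1 (Suc j) / real k)\<^sup>2)
         + U x * (\<Sum>j<k. (G.C2 (Suc j) - (G.C1 (Suc j))\<^sup>2 / real k) / (real k - 1)))"
      unfolding epoch_mean_Q[OF that] avg sum.distrib sum_distrib_left ..
    then show ?thesis
      unfolding G.sum_coefficient[symmetric] G.square_coefficient[symmetric] by (simp only: distrib_left mult_ac)
  qed
  have "epoch_mean (\<lambda>x. U x + c * (S x)\<^sup>2) x = l * (U x + c * (S x)\<^sup>2)" if x: "x \<in> carrier_vec n" for x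
  proof -
    \<comment> \<open>Rewritten in \<open>Q\<close> and \<open>S\<^sup>2\<close>, whose epoch means
      are known.\<close>
    have "(\<lambda>x. U x + c * (S x)\<^sup>2) = (\<lambda>x. Q x + (c - 1 / real k) * (S x)\<^sup>2)"
      by (simp add: U_def algebra_simps fun_eq_iff)
    then have "epoch_mean (\<lambda>x. U x + c * (S x)\<^sup>2) x
        = epoch_mean Q x + (c - 1 / real k) * epoch_mean (\<lambda>x. (S x)\<^sup>2) x"
      by (simp add: epoch_mean_add epoch_mean_mult)
    also have "\<dots> = U x * (G.M11 + c * G.M21) + (S x)\<^sup>2 * (G.M12 + c * G.M22)"
      unfolding mean_S[OF x] mean_Q[OF x] by (simp add: algebra_simps)
    also have "\<dots> = l * (U x + c * (S x)\<^sup>2)" unfolding lc by (simp add: algebra_simps)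
    finally show ?thesis .
  qed
  then show ?thesis using that lc(1-3) unfolding G.rate_def by blast
qed

text \<open>Finite support turns the expectations over iterates into finite sums, so no
  integrability has to be discussed; the carrier part allows epoch identities to be applied to each
  iterate.\<close>

lemma set_pmf_rpcd:
  assumes "x0 \<in> carrier_vec n"
  shows "finite (set_pmf (rpcd f n x0 K)) \<and> set_pmf (rpcd f n x0 K) \<subseteq> carrier_vec n"
proof (induction K)
  case (Suc K)
  have "set_pmf (pmf_of_set {p. p permutes {..<n}}) = {p. p permutes {..<n}}"
    by (rule set_pmf_of_set[OF permutations_nonempty finite_permutations[OF finite_lessThan]])
  then show ?case using Suc rpcd_epoch_result(1)[OF _ _ refl] finite_permutations[of "{..<n}"] by auto
qed (use assms in simp)

lemma rpcd_tail_zero: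
  assumes "x0 \<in> carrier_vec n" "x \<in> set_pmf (rpcd f n x0 (Suc K))" "k \<le> i" "i < n"
  shows "x $ i = 0"
proof -
  have "set_pmf (pmf_of_set {p. p permutes {..<n}}) = {p. p permutes {..<n}}"
    by (rule set_pmf_of_set[OF permutations_nonempty finite_permutations[OF finite_lessThan]])
  then obtain y p where "y \<in> set_pmf (rpcd f n x0 K)" "p permutes {..<n}" "x = rpcd_epoch f n p y"
    using assms(2) by auto
  then show ?thesis using rpcd_epoch_result(2) set_pmf_rpcd[OF assms(1)] assms(3,4) by blast
qed

lemma expectation_rpcd:
  fixes F :: "real vec \<Rightarrow> real"
  assumes "x0 \<in> carrier_vec n"
  shows "measure_pmf.expectation (rpcd f n x0 K) F
    = (\<Sum>x\<in>set_pmf (rpcd f n x0 K). pmf (rpcd f n x0 K) x * F x)"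
  using set_pmf_rpcd[OF assms, of K] by (subst integral_measure_pmf_real[of "set_pmf (rpcd f n x0 K)"]) (auto simp: mult.commute)

lemma expectation_rpcd_Suc:
  fixes F :: "real vec \<Rightarrow> real"
  assumes "x0 \<in> carrier_vec n"
  shows "measure_pmf.expectation (rpcd f n x0 (Suc K)) F = measure_pmf.expectation (rpcd f n x0 K) (epoch_mean F)"
proof -
  have "set_pmf (pmf_of_set {p. p permutes {..<n}}) = {p. p permutes {..<n}}"
    by (rule set_pmf_of_set[OF permutations_nonempty finite_permutations[OF finite_lessThan]])
  then have "measure_pmf.expectation (rpcd f n x0 (Suc K)) F = (\<Sum>x\<in>set_pmf (rpcd f n x0 K). pmf (rpcd f n x0 K) x *\<^sub>R
      measure_pmf.expectation (map_pmf (\<lambda>p. rpcd_epoch f n p x) (pmf_of_set {p. p permutes {..<n}})) F)"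
    unfolding rpcd.simps using set_pmf_rpcd[OF assms, of K] finite_permutations[of "{..<n}"]
    by (intro pmf_expectation_bind) auto
  then show ?thesis unfolding expectation_rpcd[OF assms, of K] by (simp add: epoch_mean_def)
qed

lemma expectation_rpcd_mono:
  fixes F G :: "real vec \<Rightarrow> real"
  assumes "x0 \<in> carrier_vec n" "\<And>x. x \<in> set_pmf (rpcd f n x0 K) \<Longrightarrow> F x \<le> G x"
  shows "measure_pmf.expectation (rpcd f n x0 K) F \<le> measure_pmf.expectation (rpcd f n x0 K) G"
  unfolding expectation_rpcd[OF assms(1)] using assms(2) by (intro sum_mono mult_left_mono) auto

lemma expectation_rpcd_mult:
  fixes F :: "real vec \<Rightarrow> real"
  assumes "x0 \<in> carrier_vec n"
  shows "measure_pmf.expectation (rpcd f n x0 K) (\<lambda>x. c * F x) = c * measure_pmf.expectation (rpcd f n x0 K) F"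
  unfolding expectation_rpcd[OF assms] by (simp add: sum_distrib_left mult_ac)

lemma expectation_eigenform:
  fixes F :: "real vec \<Rightarrow> real"
  assumes "x0 \<in> carrier_vec n" and eig: "\<And>x. x \<in> carrier_vec n \<Longrightarrow> epoch_mean F x = l * F x"
  shows "measure_pmf.expectation (rpcd f n x0 K) F = l ^ K * F x0"
proof (induction K)
  case (Suc K)
  have "measure_pmf.expectation (rpcd f n x0 (Suc K)) F = measure_pmf.expectation (rpcd f n x0 K) (\<lambda>x. l * F x)"
    unfolding expectation_rpcd_Suc[OF assms(1)] expectation_rpcd[OF assms(1), of K]
    using set_pmf_rpcd[OF assms(1), of K] eig by (intro sum.cong) auto
  then show ?case by (simp add: expectation_rpcd_mult[OF assms(1)] Suc.IH)
qed simp

lemma expectation_norm_eq_Q: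
  assumes "x0 \<in> carrier_vec n" "1 \<le> K"
  shows "measure_pmf.expectation (rpcd f n x0 K) (\<lambda>x. (euclid_norm x)\<^sup>2) = measure_pmf.expectation (rpcd f n x0 K) Q"
  unfolding expectation_rpcd[OF assms(1)]
proof (intro sum.cong refl arg_cong2[of _ _ _ _ "(*)"])
  fix x assume x: "x \<in> set_pmf (rpcd f n x0 K)"
  obtain m where m: "K = Suc m" using assms(2) by (cases K) auto
  have xc: "x \<in> carrier_vec n" using set_pmf_rpcd[OF assms(1)] x by blast
  have eq: "x \<bullet> x = (\<Sum>i<n. (x $ i)\<^sup>2)"
    using xc by (simp add: scalar_prod_def power2_eq_square atLeast0LessThan)
  then have "(euclid_norm x)\<^sup>2 = (\<Sum>i<n. (x $ i)\<^sup>2)"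
    unfolding euclid_norm_def by (simp add: sum_nonneg)
  also have "\<dots> = Q x" unfolding Q_def
    using rpcd_tail_zero[OF assms(1)] x k_le_n by (intro sum.mono_neutral_right) (auto simp: m)
  finally show "(euclid_norm x)\<^sup>2 = Q x" .
qed

text \<open>Both forms combine the nonnegative \<open>U\<close> and \<open>S\<^sup>2\<close> with
  positive weights; the constants are the smaller and the larger of the two weight ratios 1 and
  \<open>1 / (k * c)\<close>.\<close>

lemma Q_comparable:
  assumes "0 < c"
  obtains c1 c2 where "0 < c1" "0 < c2"
    "\<And>x. c1 * (U x + c * (S x)\<^sup>2) \<le> Q x" "\<And>x. Q x \<le> c2 * (U x + c * (S x)\<^sup>2)"
proof -
  define c1 where "c1 = min 1 (1 / (real k * c))"
  define c2 where "c2 = max 1 (1 / (real k * c))"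
  have Q: "Q x = 1 * U x + (1 / (real k * c)) * (c * (S x)\<^sup>2)" for x
    using assms k_real by (simp add: U_def)
  have nn: "0 \<le> U x" "0 \<le> c * (S x)\<^sup>2" for x using U_nonneg assms by auto
  show ?thesis
  proof (rule that)
    show "0 < c1" "0 < c2" using assms k_real by (auto simp: c1_def c2_def)
    show "c1 * (U x + c * (S x)\<^sup>2) \<le> Q x" for x
      unfolding Q distrib_left using nn by (intro add_mono mult_right_mono) (auto simp: c1_def)
    show "Q x \<le> c2 * (U x + c * (S x)\<^sup>2)" for x
      unfolding Q distrib_left using nn by (intro add_mono mult_right_mono) (auto simp: c2_def)
  qed
qed

text \<open>Dividing by \<open>d\<close>, which will be the squared norm of the initial point, only
  changes the constants in the geometric bounds.\<close>

lemma rpcd_limit_block: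
  assumes x0: "x0 \<in> carrier_vec n" and d: "0 < d"
  shows "\<exists>L. (\<lambda>K. (measure_pmf.expectation (rpcd f n x0 K) (\<lambda>x. (euclid_norm x)\<^sup>2) / d) powr (1 / real K)) \<longlonglongrightarrow> L
    \<and> L \<le> max ((1 - 1 / real k) ^ k) ((1 - \<sigma> / real k) ^ (2 * k))"
proof -
  define N where "N K = measure_pmf.expectation (rpcd f n x0 K) Q" for K
  define M where "M K = measure_pmf.expectation (rpcd f n x0 K) (\<lambda>x. (euclid_norm x)\<^sup>2) / d" for K
  have M: "M K = N K / d" if "1 \<le> K" for K
    using expectation_norm_eq_Q[OF x0 that] by (simp add: M_def N_def)
  have rate_nonneg: "0 \<le> max ((1 - 1 / real k) ^ k) ((1 - \<sigma> / real k) ^ (2 * k))"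
    by (simp add: le_max_iff_disj)
  have zero: ?thesis if "\<And>K. 1 \<le> K \<Longrightarrow> N K = 0"
  proof -
    \<comment> \<open>Only \<open>K \<ge> 1\<close> matters here, and
      \<open>0 powr y = 0\<close>.\<close>
    have "(\<lambda>K. M K powr (1 / real K)) \<longlonglongrightarrow> 0"
      using that M by (intro tendsto_eventually eventually_mono[OF eventually_ge_at_top[of 1]]) auto
    then show ?thesis using rate_nonneg unfolding M_def by blast
  qed
  show ?thesis
  proof (cases "\<sigma> < 1")
    case False
    then have "\<sigma> = 1" using \<sigma>_le_1 by simp
    \<comment> \<open>Without coupling one epoch reaches the minimizer: the factor
      \<open>(1 - \<sigma>) / \<sigma>\<close> in \<open>epoch_mean_Q\<close> vanishes.\<close>
    then have "epoch_mean Q x = 0 * Q x" if "x \<in> carrier_vec n" for x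
      using epoch_mean_Q[OF that] by simp
    from expectation_eigenform[OF x0 this] have "N K = 0" if "1 \<le> K" for K
      using that by (simp add: N_def)
    then show ?thesis by (rule zero)
  next
    case True
    obtain l c where lc: "0 < l" "l \<le> max ((1 - 1 / real k) ^ k) ((1 - \<sigma> / real k) ^ (2 * k))" "0 < c"
      and eig: "\<And>x. x \<in> carrier_vec n \<Longrightarrow> epoch_mean (\<lambda>x. U x + c * (S x)\<^sup>2) x = l * (U x + c * (S x)\<^sup>2)"
      using epoch_mean_eigenform[OF True] by blast
    define F where "F = (\<lambda>x. U x + c * (S x)\<^sup>2)"
    obtain c1 c2 where c: "0 < c1" "0 < c2" "\<And>x. c1 * F x \<le> Q x" "\<And>x. Q x \<le> c2 * F x"
      using Q_comparable[OF lc(3)] unfolding F_def by blast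
    have EF: "measure_pmf.expectation (rpcd f n x0 K) F = l ^ K * F x0" for K
      using expectation_eigenform[OF x0 eig] by (simp add: F_def)
    have lower: "c1 * (l ^ K * F x0) \<le> N K" for K
      using expectation_rpcd_mono[OF x0, of K "\<lambda>x. c1 * F x" Q] c(3) unfolding N_def expectation_rpcd_mult[OF x0] EF by blast
    have upper: "N K \<le> c2 * (l ^ K * F x0)" for K
      using expectation_rpcd_mono[OF x0, of K Q "\<lambda>x. c2 * F x"] c(4) unfolding N_def expectation_rpcd_mult[OF x0] EF by blast
    have "0 \<le> F x0" using U_nonneg lc(3) by (simp add: F_def)
    then consider "F x0 = 0" | "0 < F x0" by linarith
    then show ?thesis
    proof cases
      case 1
      then show ?thesis using lower upper by (intro zero) (auto intro: antisym)
    next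
      case 2
      have "(\<lambda>K. M K powr (1 / real K)) \<longlonglongrightarrow> l"
      proof (rule tendsto_root_geometric_bounds[of "c1 * F x0 / d" "c2 * F x0 / d"])
        show "c1 * F x0 / d * l ^ K \<le> M K" if "1 \<le> K" for K
          using divide_right_mono[OF lower[of K], of d] d by (simp add: M[OF that] mult_ac)
        show "M K \<le> c2 * F x0 / d * l ^ K" if "1 \<le> K" for K
          using divide_right_mono[OF upper[of K], of d] d by (simp add: M[OF that] mult_ac)
      qed (use 2 c lc d in auto)
      then show ?thesis using lc(2) unfolding M_def by blast
    qed
  qed
qed

end

theorem theorem3p3:
  fixes n :: nat and \<sigma> :: real and A :: "real mat" and x0 :: "real vec"
  assumes "n \<ge> 2"
    and "0 < \<sigma>" and "\<sigma> \<le> 1"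
    and "A \<in> A_class n \<sigma>"
    and "x0 \<in> carrier_vec n" and "x0 \<noteq> 0\<^sub>v n"
  shows "\<exists>L. (\<lambda>K. (measure_pmf.expectation (rpcd (quadratic A) n x0 K) (\<lambda>x. (euclid_norm x)\<^sup>2)
                    / (euclid_norm x0)\<^sup>2) powr (1 / real K)) \<longlonglongrightarrow> L
           \<and> L \<le> max ((1 - 1 / real n) ^ n) ((1 - \<sigma> / real n) ^ (2 * n))"
proof -
  obtain k w where kw: "2 \<le> k" "k \<le> n" "\<And>i. i < n \<Longrightarrow> w i * w i = (1 :: real)"
    "\<And>i j. i < n \<Longrightarrow> j < n \<Longrightarrow>
      A $$ (i, j) = w i * w j * (if i = j then 1 else if i < k \<and> j < k then 1 - \<sigma> else 0)"
    using A_class_entries[OF assms(4)] by metis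
  interpret rpcd_block n k \<sigma> A w
    using kw assms by unfold_locales auto
  have "0 < x0 \<bullet> x0"
  proof -
    obtain i where i: "i < n" "x0 $ i \<noteq> 0" using assms(5,6) by (metis eq_vecI carrier_vecD index_zero_vec)
    have "x0 \<bullet> x0 = (\<Sum>i<n. x0 $ i * x0 $ i)" using assms(5) by (simp add: scalar_prod_def atLeast0LessThan)
    also have "\<dots> > 0" using i by (intro sum_pos2[of _ i]) (auto simp: zero_less_mult_iff)
    finally show ?thesis .
  qed
  then have "0 < (euclid_norm x0)\<^sup>2" by (simp add: euclid_norm_def)
  from rpcd_limit_block[OF assms(5) this] obtain L where
    L: "(\<lambda>K. (measure_pmf.expectation (rpcd f n x0 K) (\<lambda>x. (euclid_norm x)\<^sup>2)
        / (euclid_norm x0)\<^sup>2) powr (1 / real K)) \<longlonglongrightarrow> L"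
      "L \<le> max ((1 - 1 / real k) ^ k) ((1 - \<sigma> / real k) ^ (2 * k))" by blast
  have "(1 - 1 / real k) ^ k \<le> (1 - 1 / real n) ^ n"
    using kw by (intro one_minus_div_power_mono) auto
  moreover have "(1 - \<sigma> / real k) ^ (2 * k) \<le> (1 - \<sigma> / real n) ^ (2 * n)"
  proof -
    \<comment> \<open>Taking out the square makes the exponent agree with the denominator, as
      \<open>one_minus_div_power_mono\<close> requires.\<close>
    have "((1 - \<sigma> / real k) ^ k)\<^sup>2 \<le> ((1 - \<sigma> / real n) ^ n)\<^sup>2"
      using kw assms(2,3) by (intro power_mono one_minus_div_power_mono) (auto simp: divide_le_eq)
    then show ?thesis by (simp only: power_mult[symmetric] mult.commute)
  qed
  ultimately show ?thesis using L by (intro exI[of _ L]) auto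
qed

end
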